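(* Let $\delta \in (0,1]$ and suppose the number of experiments satisfies $N \geq 24(n_x+n_u)\log(54/\delta)$. Then with probability at least $1-\delta$, the least-squares estimates $(\hat A,\hat B)$ satisfy both $$\|\hat A - A\|_2 \leq 8\sigma_w\,\lambda_{\min}^{-1/2}(\Sigma_x)\sqrt{\frac{(2n_x+n_u)\log(54/\delta)}{N}}$$ and $$\|\hat B - B\|_2 \leq \frac{8\sigma_w}{\sigma_u}\sqrt{\frac{(2n_x+n_u)\log(54/\delta)}{N}}.$$
   Context: Let $A\in\mathbb{R}^{n_x\times n_x}$, $B\in\mathbb{R}^{n_x\times n_u}$, $\sigma_w,\sigma_u>0$, and let $T\ge 1$ be an integer. Consider $N$ independent experiments $i=1,\dots,N$ on the linear system $$x^{(i)}_{t+1} = A x^{(i)}_t + B u^{(i)}_t + w^{(i)}_t,\qquad x_0^{(i)}=0,\qquad t=0,\dots,T,$$ where all $w^{(i)}_t\sim\mathcal{N}(0,\sigma_w^2 I_{n_x})$ and $u^{(i)}_t\sim\mathcal{N}(0,\sigma_u^2 I_{n_u})$ are mutually independent over $i$ and $t$ and of each other. The estimates use only the last transition of each experiment: $$(\hat A,\hat B)\in\arg\min_{(A',B')}\sum_{i=1}^N \big\|x^{(i)}_{T+1}-A'x^{(i)}_T-B'u^{(i)}_T\big\|_2^2 ,$$ where the minimum is over $A'\in\mathbb{R}^{n_x\times n_x}$, $B'\in\mathbb{R}^{n_x\times n_u}$ (the minimizer is almost surely unique for $N\ge n_x+n_u$). Define $$\Sigma_x := \sigma_u^2\sum_{t=0}^{T-1}A^tBB^\top(A^\top)^t+\sigma_w^2\sum_{t=0}^{T-1}A^t(A^\top)^t,$$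 the covariance of $x_T^{(i)}$. For matrices $\|\cdot\|_2$ is the spectral norm; $\lambda_{\min}$ is the minimum eigenvalue; $\log$ is the natural logarithm. *)

theory Defs
  imports "HOL-Probability.Probability"
begin

(* The power operation that the type real^'n^'n inherits from the type classes is entrywise;
   powers of a matrix with respect to the matrix product ** are therefore defined here. *)
primrec matpow :: "real^'n^'n \<Rightarrow> nat \<Rightarrow> real^'n^'n" where
  "matpow A 0 = mat 1"
| "matpow A (Suc t) = A ** matpow A t"

(* The norm on real^'n is Euclidean, so the induced operator norm is the spectral norm. *)
definition spectral_norm :: "real^'n^'m \<Rightarrow> real" where
  "spectral_norm A = onorm (\<lambda>v. A *v v)"

definition eigenvalues :: "real^'n^'n \<Rightarrow> real set" where
  "eigenvalues S = {l. \<exists>v. v \<noteq> 0 \<and> S *v v = l *\<^sub>R v}"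

definition min_eigenvalue :: "real^'n^'n \<Rightarrow> real" where
  "min_eigenvalue S = Min (eigenvalues S)"

(* Lebesgue density of N(0, \<sigma>^2 I); it equals
   (2 * pi * \<sigma>^2) powr (- n / 2) * exp (- norm v ^ 2 / (2 * \<sigma>^2)) for n = CARD('n). *)
definition gaussian_density :: "real \<Rightarrow> real^'n \<Rightarrow> real" where
  "gaussian_density \<sigma> v = (\<Prod>j\<in>UNIV. normal_density 0 \<sigma> (v $ j))"

definition events_of :: "'w measure \<Rightarrow> ('w \<Rightarrow> 'b::topological_space) \<Rightarrow> 'w set set" where
  "events_of M X = {X -` S \<inter> space M | S. S \<in> sets borel}"

(* The library's indep_vars needs all variables to have the same type. The noises take values in
   real^'n and the inputs in real^'u, so joint mutual independence of the family
   indexed by noise indices Inl (i, t) and input indices Inr (i, t) is stated through the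
   generated sigma-algebras, which is what indep_vars unfolds to. *)
definition mutually_independent ::
  "'w measure \<Rightarrow> (nat \<times> nat) set \<Rightarrow> (nat \<Rightarrow> nat \<Rightarrow> 'w \<Rightarrow> real^'n) \<Rightarrow>
   (nat \<Rightarrow> nat \<Rightarrow> 'w \<Rightarrow> real^'u) \<Rightarrow> bool" where
  "mutually_independent M I w u \<longleftrightarrow>
     prob_space.indep_sets M
       (case_sum (\<lambda>(i, t). events_of M (w i t)) (\<lambda>(i, t). events_of M (u i t)))
       (I <+> I)"

definition state_covariance ::
  "real^'n^'n \<Rightarrow> real^'u^'n \<Rightarrow> real \<Rightarrow> real \<Rightarrow> nat \<Rightarrow> real^'n^'n" where
  "state_covariance A B \<sigma>w \<sigma>u T =
     \<sigma>u\<^sup>2 *\<^sub>R (\<Sum>t<T. matpow A t ** B ** transpose B ** matpow (transpose A) t)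
     + \<sigma>w\<^sup>2 *\<^sub>R (\<Sum>t<T. matpow A t ** matpow (transpose A) t)"

(* Only the last transition, from time T to time T + 1, of each experiment enters the loss. *)
definition ls_loss ::
  "nat \<Rightarrow> nat \<Rightarrow> (nat \<Rightarrow> nat \<Rightarrow> real^'n) \<Rightarrow> (nat \<Rightarrow> nat \<Rightarrow> real^'u) \<Rightarrow>
   (real^'n^'n) \<times> (real^'u^'n) \<Rightarrow> real" where
  "ls_loss N T x u = (\<lambda>(A', B').
     \<Sum>i\<in>{1..N}. (norm (x i (Suc T) - A' *v x i T - B' *v u i T))\<^sup>2)"

end

(* With z = (x_T, u_T) for one experiment and Q the covariance form of z, a row combination
   theta = (Theta^T b) of the estimation error Theta satisfies the normal equation
     sum_i (theta . z_i)^2 = sum_i (b . w_i) (theta . z_i).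
   With high probability the left side is at least N Q(theta) / 3 and the right side at most (4/3) t sqrt(Q(theta)) |b| for
   all theta and b at once, where t = sigma_w sqrt(3 N (2 n_x + n_u) log(54/delta)); hence
   sqrt(Q(theta)) <= 4 t / N, and Q dominates both lambda_min(Sigma_x) |theta_x|^2 and
   sigma_u^2 |theta_u|^2.
   The two uniform bounds follow from Chernoff bounds at the points of 1/8-nets. The net of the
   directions theta is taken with respect to the norm sqrt Q, which replaces whitening of z. The cross
   term needs no conditioning on z: exp(l h g - l^2 g^2 / 2) has mean 1 for independent standard
   normal h and g. *)

theory Submission
  imports Defs
begin

section \<open>Centred Gaussian variables\<close>

text \<open>The constants have these origins. A net costs a factor 17 per dimension. The energy
  bounds run over the net of directions theta alone, so n_x + n_u dimensions enter the condition on
  N, and the 24 there comes from their tail \<open>exp (- N / 24)\<close>. The cross term runs over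
  pairs (theta, b), that is (n_x + n_u) + n_x dimensions, whence 2 n_x + n_u. The failure
  probability splits into three parts of at most \<delta>/3 each (energy too large, energy too
  small, cross term); 54 = 3 * 18 works because 17/54 is below 1/3. The final 8 is 4 * sqrt 3
  rounded up. A Euclidean net for theta would bring the condition number of Q into the estimates,
  whereas the size of a net in the norm sqrt Q depends on the dimension alone. The upper energy
  bound has two roles. At net points it caps the compensator l^2 g^2 / 2 of the cross term. Together
  with the lower bound it controls the absolute deviation of the energy from N Q, and it is this
  two-sided control that passes from the net to all directions.\<close>

lemma nn_integral_lborel_vec_prod:
  fixes F :: "'n::finite \<Rightarrow> real \<Rightarrow> ennreal"
  assumes F [measurable]: "\<And>j. F j \<in> borel_measurable borel"
  shows "(\<integral>\<^sup>+v. (\<Prod>j\<in>UNIV. F j (v $ j)) \<partial>(lborel :: (real^'n) measure)) =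
    (\<Prod>j\<in>UNIV. \<integral>\<^sup>+y. F j y \<partial>lborel)"
proof -
  define ax :: "'n \<Rightarrow> real^'n" where "ax = (\<lambda>j. axis j 1)"
  have inj: "inj ax"
    by (auto simp: inj_def ax_def axis_eq_axis)
  have Basis: "(Basis :: (real^'n) set) = range ax"
    by (auto simp: Basis_vec_def ax_def)
  have inner_ax: "v \<bullet> ax j = v $ j" for v :: "real^'n" and j
    by (simp add: ax_def inner_axis)
  define G where "G b = F (inv ax b)" for b
  have "(\<Prod>j\<in>UNIV. F j (v $ j)) = (\<Prod>b\<in>Basis. G b (v \<bullet> b))" for v :: "real^'n"
    unfolding Basis using inj
    by (subst prod.reindex) (auto simp: G_def inner_ax)
  then have "(\<integral>\<^sup>+v. (\<Prod>j\<in>UNIV. F j (v $ j)) \<partial>(lborel :: (real^'n) measure)) =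
      (\<Prod>b\<in>Basis. \<integral>\<^sup>+y. G b y \<partial>lborel)"
    by (simp, subst nn_integral_lborel_prod) (auto simp: G_def)
  also have "\<dots> = (\<Prod>j\<in>UNIV. \<integral>\<^sup>+y. F j y \<partial>lborel)"
    unfolding Basis using inj by (subst prod.reindex) (auto simp: G_def)
  finally show ?thesis .
qed

context prob_space
begin

text \<open>The product density makes box probabilities factorise. Taking \<open>S j = UNIV\<close>
  in the coordinates of no interest gives both the marginals and the independence of the
  components.\<close>

lemma gaussian_vector_box:
  fixes X :: "'a \<Rightarrow> real^'n"
  assumes X: "distributed M lborel X (\<lambda>v. ennreal (gaussian_density \<sigma> v))"
    and S [measurable]: "\<And>j. S j \<in> sets borel"
  shows "emeasure M (\<Inter>j. (\<lambda>\<omega>. X \<omega> $ j) -` S j \<inter> space M) =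
    (\<Prod>j\<in>UNIV. \<integral>\<^sup>+y. ennreal (normal_density 0 \<sigma> y) * indicator (S j) y \<partial>lborel)"
proof -
  let ?B = "{v :: real^'n. \<forall>j. v $ j \<in> S j}"
  have B: "?B \<in> sets lborel" by measurable
  have "(\<Inter>j. (\<lambda>\<omega>. X \<omega> $ j) -` S j \<inter> space M) = X -` ?B \<inter> space M"
    by auto
  then have "emeasure M (\<Inter>j. (\<lambda>\<omega>. X \<omega> $ j) -` S j \<inter> space M) =
      (\<integral>\<^sup>+v. ennreal (gaussian_density \<sigma> v) * indicator ?B v \<partial>lborel)"
    using distributed_emeasure[OF X B] by simp
  also have "\<dots> = (\<integral>\<^sup>+v. (\<Prod>j\<in>UNIV. ennreal (normal_density 0 \<sigma> (v $ j)) * indicator (S j) (v $ j))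
      \<partial>(lborel :: (real^'n) measure))"
    by (intro nn_integral_cong)
      (auto simp: gaussian_density_def prod.distrib prod_ennreal indicator_def split: if_splits)
  also have "\<dots> = (\<Prod>j\<in>UNIV. \<integral>\<^sup>+y. ennreal (normal_density 0 \<sigma> y) * indicator (S j) y \<partial>lborel)"
    by (intro nn_integral_lborel_vec_prod) measurable
  finally show ?thesis .
qed

lemma gaussian_vector_component:
  fixes X :: "'a \<Rightarrow> real^'n"
  assumes X: "distributed M lborel X (\<lambda>v. ennreal (gaussian_density \<sigma> v))" and "\<sigma> > 0"
  shows "distributed M lborel (\<lambda>\<omega>. X \<omega> $ k) (\<lambda>y. ennreal (normal_density 0 \<sigma> y))"
proof -
  have [measurable]: "X \<in> borel_measurable M"
    using distributed_measurable[OF X] by simp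
  have "X \<omega> $ k = X \<omega> \<bullet> axis k 1" for \<omega> by (simp add: inner_axis)
  then have meas [measurable]: "random_variable borel (\<lambda>\<omega>. X \<omega> $ k)" by simp
  interpret N: prob_space "density lborel (normal_density 0 \<sigma>)"
    using \<open>\<sigma> > 0\<close> by (rule prob_space_normal_density)
  have one: "(\<integral>\<^sup>+y. ennreal (normal_density 0 \<sigma> y) \<partial>lborel) = 1"
    using N.emeasure_space_1 by (simp add: emeasure_density)
  have "distr M borel (\<lambda>\<omega>. X \<omega> $ k) = density lborel (normal_density 0 \<sigma>)"
  proof (rule measure_eqI)
    fix S assume "S \<in> sets (distr M borel (\<lambda>\<omega>. X \<omega> $ k))"
    then have [measurable]: "S \<in> sets borel" by simp
    define S' where "S' j = (if j = k then S else UNIV)" for j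
    have [measurable]: "S' j \<in> sets borel" for j by (simp add: S'_def)
    have "(\<Inter>j. (\<lambda>\<omega>. X \<omega> $ j) -` S' j \<inter> space M) = (\<lambda>\<omega>. X \<omega> $ k) -` S \<inter> space M"
      by (auto simp: S'_def split: if_splits)
    then have "emeasure M ((\<lambda>\<omega>. X \<omega> $ k) -` S \<inter> space M) =
        (\<Prod>j\<in>UNIV. \<integral>\<^sup>+y. ennreal (normal_density 0 \<sigma> y) * indicator (S' j) y \<partial>lborel)"
      using gaussian_vector_box[OF X, of S'] by simp
    also have "\<dots> = (\<Prod>j\<in>UNIV. if j = k then
        \<integral>\<^sup>+y. ennreal (normal_density 0 \<sigma> y) * indicator S y \<partial>lborel else 1)"
      by (intro prod.cong) (auto simp: S'_def one)
    also have "\<dots> = (\<integral>\<^sup>+y. ennreal (normal_density 0 \<sigma> y) * indicator S y \<partial>lborel)"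
      by (simp add: prod.delta)
    finally show "emeasure (distr M borel (\<lambda>\<omega>. X \<omega> $ k)) S =
        emeasure (density lborel (normal_density 0 \<sigma>)) S"
      by (simp add: emeasure_distr emeasure_density)
  qed simp
  then show ?thesis
    unfolding distributed_def by (auto cong: distr_cong)
qed

lemma gaussian_vector_indep_components:
  fixes X :: "'a \<Rightarrow> real^'n"
  assumes X: "distributed M lborel X (\<lambda>v. ennreal (gaussian_density \<sigma> v))" and "\<sigma> > 0"
  shows "indep_vars (\<lambda>_. borel) (\<lambda>j \<omega>. X \<omega> $ j) UNIV"
  unfolding indep_vars_def2
proof (intro conjI ballI indep_setsI)
  have [measurable]: "X \<in> borel_measurable M"
    using distributed_measurable[OF X] by simp
  have "X \<omega> $ j = X \<omega> \<bullet> axis j 1" for \<omega> j by (simp add: inner_axis)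
  then show meas [measurable]: "random_variable borel (\<lambda>\<omega>. X \<omega> $ j)" for j by simp
  show "{(\<lambda>\<omega>. X \<omega> $ i) -` A \<inter> space M |A. A \<in> sets borel} \<subseteq> events" for i
    using meas by (auto intro: measurable_sets)
  fix Ev J
  assume "\<forall>j\<in>J. Ev j \<in> {(\<lambda>\<omega>. X \<omega> $ j) -` A \<inter> space M |A. A \<in> sets borel}"
  then have "\<forall>j\<in>J. \<exists>A. A \<in> sets borel \<and> Ev j = (\<lambda>\<omega>. X \<omega> $ j) -` A \<inter> space M" by auto
  then obtain S where S: "\<And>j. j \<in> J \<Longrightarrow> S j \<in> sets borel"
      "\<And>j. j \<in> J \<Longrightarrow> Ev j = (\<lambda>\<omega>. X \<omega> $ j) -` S j \<inter> space M"
    by metis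
  assume "J \<noteq> {}"
  define S' where "S' j = (if j \<in> J then S j else UNIV)" for j
  have [measurable]: "S' j \<in> sets borel" for j using S by (simp add: S'_def)
  have "(\<Inter>j\<in>J. Ev j) = (\<Inter>j. (\<lambda>\<omega>. X \<omega> $ j) -` S' j \<inter> space M)"
    using \<open>J \<noteq> {}\<close> by (force simp: S S'_def split: if_splits)
  then have "emeasure M (\<Inter>j\<in>J. Ev j) =
      (\<Prod>j\<in>UNIV. \<integral>\<^sup>+y. ennreal (normal_density 0 \<sigma> y) * indicator (S' j) y \<partial>lborel)"
    using gaussian_vector_box[OF X, of S'] by simp
  also have "\<dots> = (\<Prod>j\<in>UNIV. emeasure M ((\<lambda>\<omega>. X \<omega> $ j) -` S' j \<inter> space M))"
    using distributed_emeasure[OF gaussian_vector_component[OF X \<open>\<sigma> > 0\<close>]] by simp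
  also have "\<dots> = (\<Prod>j\<in>UNIV. if j \<in> J then emeasure M (Ev j) else 1)"
    by (intro prod.cong) (auto simp: S'_def S emeasure_space_1)
  also have "\<dots> = (\<Prod>j\<in>J. emeasure M (Ev j))"
    by (simp add: prod.If_cases)
  finally show "prob (\<Inter>j\<in>J. Ev j) = (\<Prod>j\<in>J. prob (Ev j))"
    by (simp add: emeasure_eq_measure prod_ennreal prod_nonneg)
qed

text \<open>Centred Gaussians are represented by their characteristic functions, so that the degenerate
  case of variance 0 needs no separate treatment.\<close>

definition gaussian_rv :: "real \<Rightarrow> ('a \<Rightarrow> real) \<Rightarrow> bool" where
  "gaussian_rv s X \<longleftrightarrow> random_variable borel X \<and>
     (\<forall>t. char (distr M borel X) t = complex_of_real (exp (- s * t\<^sup>2 / 2)))"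

lemma char_distr_scale:
  fixes X :: "'a \<Rightarrow> real"
  assumes [measurable]: "random_variable borel X"
  shows "char (distr M borel (\<lambda>\<omega>. c * X \<omega>)) t = char (distr M borel X) (c * t)"
  by (simp add: char_def integral_distr mult_ac)

lemma gaussian_rv_scale:
  assumes "gaussian_rv s X"
  shows "gaussian_rv (c\<^sup>2 * s) (\<lambda>\<omega>. c * X \<omega>)"
  using assms unfolding gaussian_rv_def
  by (auto simp: char_distr_scale power_mult_distrib mult_ac)

text \<open>Characteristic functions of independent summands multiply, so the variances in the
  exponent add.\<close>

lemma gaussian_rv_sum:
  assumes "indep_vars (\<lambda>_. borel) X I" and "\<And>i. i \<in> I \<Longrightarrow> gaussian_rv (s i) (X i)"
  shows "gaussian_rv (\<Sum>i\<in>I. s i) (\<lambda>\<omega>. \<Sum>i\<in>I. X i \<omega>)"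
proof (cases "finite I")
  case True
  have "random_variable borel (\<lambda>\<omega>. \<Sum>i\<in>I. X i \<omega>)"
    using assms(2) by (intro borel_measurable_sum) (auto simp: gaussian_rv_def)
  moreover have "char (distr M borel (\<lambda>\<omega>. \<Sum>i\<in>I. X i \<omega>)) t =
      complex_of_real (exp (- (\<Sum>i\<in>I. s i) * t\<^sup>2 / 2))" for t
  proof -
    have "char (distr M borel (\<lambda>\<omega>. \<Sum>i\<in>I. X i \<omega>)) t =
        (\<Prod>i\<in>I. complex_of_real (exp (- s i * t\<^sup>2 / 2)))"
      using assms by (simp add: char_distr_sum gaussian_rv_def)
    also have "\<dots> = complex_of_real (exp (\<Sum>i\<in>I. - s i * t\<^sup>2 / 2))"
      using True by (simp add: exp_sum)
    also have "(\<Sum>i\<in>I. - s i * t\<^sup>2 / 2) = - (\<Sum>i\<in>I. s i) * t\<^sup>2 / 2"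
      by (simp add: sum_distrib_right sum_negf sum_divide_distrib)
    finally show ?thesis .
  qed
  ultimately show ?thesis by (simp add: gaussian_rv_def)
next
  \<comment> \<open>For infinite \<open>I\<close> both sums are 0 by convention, and the constant 0
    is the Gaussian of variance 0.\<close>
  case False
  then show ?thesis
    by (simp add: gaussian_rv_def char_def integral_distr prob_space del: distr_const)
qed

lemma distributed_imp_gaussian_rv:
  assumes X: "distributed M lborel X (\<lambda>y. ennreal (normal_density 0 \<sigma> y))" and "\<sigma> > 0"
  shows "gaussian_rv (\<sigma>\<^sup>2) X"
proof -
  have [measurable]: "random_variable borel X"
    using distributed_measurable[OF X] by simp
  have "distributed M lborel (\<lambda>\<omega>. 0 + (1 / \<sigma>) * X \<omega>)
      (\<lambda>y. ennreal (normal_density (0 + (1 / \<sigma>) * 0) (\<bar>1 / \<sigma>\<bar> * \<sigma>) y))"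
    using \<open>\<sigma> > 0\<close> by (intro normal_density_affine X) auto
  then have "distributed M lborel (\<lambda>\<omega>. X \<omega> / \<sigma>) (\<lambda>y. ennreal (std_normal_density y))"
    using \<open>\<sigma> > 0\<close> by simp
  then have "distr M lborel (\<lambda>\<omega>. X \<omega> / \<sigma>) = std_normal_distribution"
    by (simp add: distributed_def)
  then have D: "distr M borel (\<lambda>\<omega>. X \<omega> / \<sigma>) = std_normal_distribution"
    by (metis distr_cong sets_lborel)
  have "gaussian_rv 1 (\<lambda>\<omega>. X \<omega> / \<sigma>)"
    by (simp add: gaussian_rv_def D char_std_normal_distribution)
  from gaussian_rv_scale[OF this, of \<sigma>] show ?thesis
    using \<open>\<sigma> > 0\<close> by simp
qed

lemma gaussian_vector_inner:
  fixes X :: "'a \<Rightarrow> real^'n"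
  assumes X: "distributed M lborel X (\<lambda>v. ennreal (gaussian_density \<sigma> v))" and "\<sigma> > 0"
  shows "gaussian_rv (\<sigma>\<^sup>2 * (norm c)\<^sup>2) (\<lambda>\<omega>. c \<bullet> X \<omega>)"
proof -
  have "indep_vars (\<lambda>_. borel) (\<lambda>j \<omega>. c $ j * X \<omega> $ j) UNIV"
    by (rule indep_vars_compose2[OF gaussian_vector_indep_components[OF assms]]) measurable
  then have "gaussian_rv (\<Sum>j\<in>UNIV. (c $ j)\<^sup>2 * \<sigma>\<^sup>2) (\<lambda>\<omega>. \<Sum>j\<in>UNIV. c $ j * X \<omega> $ j)"
    by (intro gaussian_rv_sum gaussian_rv_scale distributed_imp_gaussian_rv
        gaussian_vector_component[OF X] \<open>\<sigma> > 0\<close>)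
  moreover have "(\<Sum>j\<in>UNIV. (c $ j)\<^sup>2 * \<sigma>\<^sup>2) = \<sigma>\<^sup>2 * (norm c)\<^sup>2"
    unfolding power2_norm_eq_inner inner_vec_def
    by (simp add: sum_distrib_left power2_eq_square mult_ac)
  ultimately show ?thesis by (simp add: inner_vec_def)
qed

text \<open>The way back from characteristic functions to a density, in which the exponential
  moments are computed: Levy's uniqueness theorem.\<close>

lemma gaussian_rv_std:
  assumes "gaussian_rv 1 X"
  shows "distr M borel X = std_normal_distribution"
proof (rule Levy_uniqueness)
  have [measurable]: "random_variable borel X" using assms by (simp add: gaussian_rv_def)
  interpret D: prob_space "distr M borel X" by (rule prob_space_distr) simp
  show "real_distribution (distr M borel X)"
    by (simp add: real_distribution_def real_distribution_axioms_def D.prob_space_axioms)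
  show "real_distribution std_normal_distribution" by (rule real_dist_normal_dist)
  show "char (distr M borel X) = char std_normal_distribution"
    using assms by (auto simp: gaussian_rv_def char_std_normal_distribution)
qed

end

section \<open>Exponential tail bounds\<close>

text \<open>The exponential factor turns the standard normal density into \<open>r\<close> times the
  centred normal density of variance \<open>1 / (1 - 2 * s)\<close>, which has mass 1.\<close>

lemma nn_integral_std_normal_exp_square:
  assumes "s < 1 / 2"
  shows "(\<integral>\<^sup>+y. ennreal (exp (s * y\<^sup>2)) \<partial>std_normal_distribution) = ennreal (1 / sqrt (1 - 2 * s))"
proof -
  define r where "r = 1 / sqrt (1 - 2 * s)"
  have r: "r > 0" and r2: "r\<^sup>2 = 1 / (1 - 2 * s)" and s: "1 - 2 * s > 0"
    using assms by (auto simp: r_def power_divide)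
  interpret R: prob_space "density lborel (normal_density 0 r)"
    using r by (rule prob_space_normal_density)
  have one: "(\<integral>\<^sup>+y. ennreal (normal_density 0 r y) \<partial>lborel) = 1"
    using R.emeasure_space_1 by (simp add: emeasure_density)
  have eq: "std_normal_density y * exp (s * y\<^sup>2) = r * normal_density 0 r y" for y
  proof -
    have "- y\<^sup>2 / 2 + s * y\<^sup>2 = - y\<^sup>2 / (2 * r\<^sup>2)"
      using s by (simp add: r2 field_simps)
    then have "exp (- y\<^sup>2 / 2) * exp (s * y\<^sup>2) = exp (- y\<^sup>2 / (2 * r\<^sup>2))"
      by (simp add: exp_add[symmetric])
    then show ?thesis
      using r by (simp add: normal_density_def real_sqrt_mult)
  qed
  have "(\<integral>\<^sup>+y. ennreal (exp (s * y\<^sup>2)) \<partial>std_normal_distribution) =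
      (\<integral>\<^sup>+y. ennreal (std_normal_density y * exp (s * y\<^sup>2)) \<partial>lborel)"
    by (simp add: nn_integral_density ennreal_mult')
  also have "\<dots> = (\<integral>\<^sup>+y. ennreal r * ennreal (normal_density 0 r y) \<partial>lborel)"
    using r by (simp add: eq ennreal_mult')
  also have "\<dots> = ennreal r"
    by (simp add: nn_integral_cmult one)
  finally show ?thesis by (simp add: r_def)
qed

text \<open>Completing the square: the tilted density is the normal density with mean
  \<open>c\<close> and variance 1.\<close>

lemma nn_integral_std_normal_exp_shift:
  "(\<integral>\<^sup>+y. ennreal (exp (c * y - c\<^sup>2 / 2)) \<partial>std_normal_distribution) = 1"
proof -
  interpret R: prob_space "density lborel (normal_density c 1)"
    by (rule prob_space_normal_density) simp
  have eq: "std_normal_density y * exp (c * y - c\<^sup>2 / 2) = normal_density c 1 y" for y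
  proof -
    have "- y\<^sup>2 / 2 + (c * y - c\<^sup>2 / 2) = - (y - c)\<^sup>2 / 2"
      by (simp add: power2_eq_square field_simps)
    then have "exp (- y\<^sup>2 / 2) * exp (c * y - c\<^sup>2 / 2) = exp (- (y - c)\<^sup>2 / 2)"
      by (simp only: exp_add[symmetric])
    then show ?thesis by (simp add: normal_density_def)
  qed
  have "(\<integral>\<^sup>+y. ennreal (exp (c * y - c\<^sup>2 / 2)) \<partial>std_normal_distribution) =
      (\<integral>\<^sup>+y. ennreal (std_normal_density y * exp (c * y - c\<^sup>2 / 2)) \<partial>lborel)"
    by (simp add: nn_integral_density ennreal_mult')
  also have "\<dots> = 1"
    using R.emeasure_space_1 by (simp add: eq emeasure_density)
  finally show ?thesis .
qed

context prob_space
begin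

text \<open>Markov's inequality for the exponential of the sum, whose mean factorises by
  independence. The Chernoff parameter is absorbed into \<open>F\<close>, so the same bound serves
  squares and cross terms.\<close>

lemma chernoff_sum:
  fixes F :: "'i \<Rightarrow> 'a \<Rightarrow> real"
  assumes fin: "finite I" and ind: "indep_vars (\<lambda>_. borel) F I"
    and mom: "\<And>i. i \<in> I \<Longrightarrow> (\<integral>\<^sup>+\<omega>. ennreal (exp (F i \<omega>)) \<partial>M) = ennreal c" and "c \<ge> 0"
  shows "prob {\<omega> \<in> space M. a \<le> (\<Sum>i\<in>I. F i \<omega>)} \<le> c ^ card I * exp (- a)"
proof -
  have [measurable]: "\<And>i. i \<in> I \<Longrightarrow> random_variable borel (F i)"
    using ind by (auto simp: indep_vars_def)
  have "indep_vars (\<lambda>_. borel) (\<lambda>i \<omega>. ennreal (exp (F i \<omega>))) I"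
    by (rule indep_vars_compose2[OF ind]) measurable
  then have prod: "(\<integral>\<^sup>+\<omega>. (\<Prod>i\<in>I. ennreal (exp (F i \<omega>))) \<partial>M) = (\<Prod>i\<in>I. ennreal c)"
    using fin mom by (subst indep_vars_nn_integral) auto
  have exp_sum': "ennreal (exp (\<Sum>i\<in>I. F i \<omega>)) = (\<Prod>i\<in>I. ennreal (exp (F i \<omega>)))" for \<omega>
    using fin by (simp add: exp_sum prod_ennreal)
  have "emeasure M {\<omega> \<in> space M. a \<le> (\<Sum>i\<in>I. F i \<omega>)} \<le>
      emeasure M ({\<omega> \<in> space M. 1 \<le> ennreal (exp (- a)) * ennreal (exp (\<Sum>i\<in>I. F i \<omega>))} \<inter> space M)"
  proof (rule emeasure_mono)
    show "{\<omega> \<in> space M. a \<le> (\<Sum>i\<in>I. F i \<omega>)} \<subseteq>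
      {\<omega> \<in> space M. 1 \<le> ennreal (exp (- a)) * ennreal (exp (\<Sum>i\<in>I. F i \<omega>))} \<inter> space M"
      by (auto simp flip: ennreal_mult' exp_add ennreal_1 simp del: ennreal_1)
  qed measurable
  also have "\<dots> \<le> ennreal (exp (- a)) * (\<integral>\<^sup>+\<omega>. ennreal (exp (\<Sum>i\<in>I. F i \<omega>)) * indicator (space M) \<omega> \<partial>M)"
    using nn_integral_Markov_inequality[of "\<lambda>\<omega>. ennreal (exp (\<Sum>i\<in>I. F i \<omega>))" "space M" M "ennreal (exp (- a))"]
    by (auto intro: order.trans simp: Int_def conj_commute)
  also have "(\<integral>\<^sup>+\<omega>. ennreal (exp (\<Sum>i\<in>I. F i \<omega>)) * indicator (space M) \<omega> \<partial>M) =
      (\<integral>\<^sup>+\<omega>. (\<Prod>i\<in>I. ennreal (exp (F i \<omega>))) \<partial>M)"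
    by (intro nn_integral_cong) (simp add: exp_sum')
  also have "ennreal (exp (- a)) * \<dots> = ennreal (c ^ card I * exp (- a))"
    unfolding prod using \<open>c \<ge> 0\<close> by (simp add: ennreal_mult' mult.commute ennreal_power)
  finally show ?thesis
    using \<open>c \<ge> 0\<close> by (simp add: emeasure_eq_measure)
qed

lemma std_normal_exp_square:
  assumes "random_variable borel X" "distr M borel X = std_normal_distribution" "s < 1 / 2"
  shows "(\<integral>\<^sup>+\<omega>. ennreal (exp (s * (X \<omega>)\<^sup>2)) \<partial>M) = ennreal (1 / sqrt (1 - 2 * s))"
proof -
  have "(\<integral>\<^sup>+\<omega>. ennreal (exp (s * (X \<omega>)\<^sup>2)) \<partial>M) =
      (\<integral>\<^sup>+y. ennreal (exp (s * y\<^sup>2)) \<partial>distr M borel X)"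
    using assms by (subst nn_integral_distr) auto
  then show ?thesis using assms by (simp add: nn_integral_std_normal_exp_square)
qed

text \<open>For fixed g the integral over h is the shift identity with \<open>c = l * g\<close>,
  hence 1; Tonelli's theorem allows h to be integrated first.\<close>

lemma std_normal_pair_exp:
  assumes ind: "indep_var borel H borel G"
    and "distr M borel G = std_normal_distribution" "distr M borel H = std_normal_distribution"
  shows "(\<integral>\<^sup>+\<omega>. ennreal (exp (l * (H \<omega> * G \<omega>) - l\<^sup>2 / 2 * (G \<omega>)\<^sup>2)) \<partial>M) = 1"
proof -
  have [measurable]: "random_variable borel G" "random_variable borel H"
    using ind by (auto dest: indep_var_rv1 indep_var_rv2)
  interpret S: real_distribution std_normal_distribution by (rule real_dist_normal_dist)
  interpret SS: pair_sigma_finite std_normal_distribution std_normal_distribution ..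
  have "std_normal_distribution \<Otimes>\<^sub>M std_normal_distribution =
      distr M (borel \<Otimes>\<^sub>M borel) (\<lambda>\<omega>. (H \<omega>, G \<omega>))"
    using ind assms(2,3) by (simp add: indep_var_distribution_eq)
  then have "(\<integral>\<^sup>+\<omega>. ennreal (exp (l * (H \<omega> * G \<omega>) - l\<^sup>2 / 2 * (G \<omega>)\<^sup>2)) \<partial>M) =
      (\<integral>\<^sup>+z. ennreal (exp (l * (fst z * snd z) - l\<^sup>2 / 2 * (snd z)\<^sup>2))
        \<partial>(std_normal_distribution \<Otimes>\<^sub>M std_normal_distribution))"
    by (simp add: nn_integral_distr)
  also have "\<dots> = (\<integral>\<^sup>+g. \<integral>\<^sup>+h. ennreal (exp (l * (h * g) - l\<^sup>2 / 2 * g\<^sup>2))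
      \<partial>std_normal_distribution \<partial>std_normal_distribution)"
    by (subst SS.nn_integral_snd[symmetric]) simp_all
  also have "\<dots> = (\<integral>\<^sup>+g. 1 \<partial>std_normal_distribution)"
  proof (rule nn_integral_cong)
    fix g :: real
    have "(\<integral>\<^sup>+h. ennreal (exp (l * (h * g) - l\<^sup>2 / 2 * g\<^sup>2)) \<partial>std_normal_distribution) =
        (\<integral>\<^sup>+h. ennreal (exp ((l * g) * h - (l * g)\<^sup>2 / 2)) \<partial>std_normal_distribution)"
      by (intro nn_integral_cong) (simp add: power_mult_distrib mult_ac)
    then show "(\<integral>\<^sup>+h. ennreal (exp (l * (h * g) - l\<^sup>2 / 2 * g\<^sup>2)) \<partial>std_normal_distribution) = 1"
      by (simp only: nn_integral_std_normal_exp_shift)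
  qed
  also have "\<dots> = 1"
    using S.emeasure_space_1 by simp
  finally show ?thesis .
qed

lemma chi_square_upper:
  fixes G :: "'i \<Rightarrow> 'a \<Rightarrow> real"
  assumes fin: "finite I" and ind: "indep_vars (\<lambda>_. borel) G I"
    and std: "\<And>i. i \<in> I \<Longrightarrow> distr M borel (G i) = std_normal_distribution"
  shows "prob {\<omega> \<in> space M. 3 / 2 * card I \<le> (\<Sum>i\<in>I. (G i \<omega>)\<^sup>2)} \<le> exp (- real (card I) / 24)"
proof -
  let ?n = "real (card I)"
  have rv: "\<And>i. i \<in> I \<Longrightarrow> random_variable borel (G i)"
    using ind by (auto simp: indep_vars_def)
  have ind': "indep_vars (\<lambda>_. borel) (\<lambda>i \<omega>. 1 / 6 * (G i \<omega>)\<^sup>2) I"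
    by (rule indep_vars_compose2[OF ind]) measurable
  \<comment> \<open>For a threshold \<open>a * n\<close> the optimal Chernoff parameter is
    \<open>(1 - 1 / a) / 2\<close>, which is 1/6 at a = 3/2; the threshold then becomes n/4.\<close>
  have "prob {\<omega> \<in> space M. ?n / 4 \<le> (\<Sum>i\<in>I. 1 / 6 * (G i \<omega>)\<^sup>2)} \<le>
      (1 / sqrt (1 - 2 * (1 / 6))) ^ card I * exp (- (?n / 4))"
    by (intro chernoff_sum fin ind' std_normal_exp_square rv std) auto
  also have "1 / sqrt (1 - 2 * (1 / 6)) = exp (ln (3 / 2) / 2)"
    using ln_sqrt[of "3 / 2"] by (simp add: real_sqrt_divide flip: ln_sqrt)
  also have "exp (ln (3 / 2 :: real) / 2) ^ card I * exp (- (?n / 4)) = exp (?n * (ln (3 / 2) / 2 - 1 / 4))"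
    by (simp add: exp_of_nat_mult[symmetric] exp_add[symmetric] algebra_simps)
  also have "\<dots> \<le> exp (?n * (- 1 / 24))"
  proof -
    \<comment> \<open>The exponent -1/24 amounts to \<open>ln (3 / 2) \<le> 5 / 12\<close>, and the
      quadratic Taylor polynomial of exp at 5/12 just exceeds 3/2.\<close>
    have "3 / 2 \<le> exp (5 / 12 :: real)"
      using exp_lower_Taylor_quadratic[of "5 / 12"] by (simp add: power2_eq_square)
    then have "ln (3 / 2) \<le> (5 / 12 :: real)"
      by (metis exp_gt_zero ln_exp ln_le_cancel_iff zero_less_divide_iff zero_less_numeral)
    then show ?thesis by (intro exp_le_cancel_iff[THEN iffD2] mult_left_mono) auto
  qed
  finally show ?thesis
    by (simp add: sum_divide_distrib[symmetric] field_simps)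
qed

lemma chi_square_lower:
  fixes G :: "'i \<Rightarrow> 'a \<Rightarrow> real"
  assumes fin: "finite I" and ind: "indep_vars (\<lambda>_. borel) G I"
    and std: "\<And>i. i \<in> I \<Longrightarrow> distr M borel (G i) = std_normal_distribution"
  shows "prob {\<omega> \<in> space M. (\<Sum>i\<in>I. (G i \<omega>)\<^sup>2) \<le> 1 / 2 * card I} \<le> exp (- real (card I) / 24)"
proof -
  let ?n = "real (card I)"
  have rv: "\<And>i. i \<in> I \<Longrightarrow> random_variable borel (G i)"
    using ind by (auto simp: indep_vars_def)
  have ind': "indep_vars (\<lambda>_. borel) (\<lambda>i \<omega>. - 1 / 2 * (G i \<omega>)\<^sup>2) I"
    by (rule indep_vars_compose2[OF ind]) measurable
  \<comment> \<open>The same formula for the optimal parameter gives -1/2 at a = 1/2. The rate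
    \<open>ln 2 / 2 - 1 / 4\<close> exceeds 1/24 already by \<open>ln 2 \<ge> 2 / 3\<close>.\<close>
  have "prob {\<omega> \<in> space M. - ?n / 4 \<le> (\<Sum>i\<in>I. - 1 / 2 * (G i \<omega>)\<^sup>2)} \<le>
      (1 / sqrt (1 - 2 * (- 1 / 2))) ^ card I * exp (- (- ?n / 4))"
    by (intro chernoff_sum fin ind' std_normal_exp_square rv std) auto
  also have "1 / sqrt (1 - 2 * (- 1 / 2)) = exp (- ln 2 / 2)"
    by (simp add: exp_minus inverse_eq_divide flip: ln_sqrt)
  also have "exp (- ln 2 / 2 :: real) ^ card I * exp (- (- ?n / 4)) = exp (?n * (1 / 4 - ln 2 / 2))"
    by (simp add: exp_of_nat_mult[symmetric] exp_add[symmetric] algebra_simps)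
  also have "\<dots> \<le> exp (?n * (- 1 / 24))"
    using ln2_ge_two_thirds by (intro exp_le_cancel_iff[THEN iffD2] mult_left_mono) auto
  finally show ?thesis
    by (simp add: sum_divide_distrib[symmetric] sum_negf field_simps)
qed

text \<open>On the event the compensator is at most \<open>l^2 / 2 * (3 / 2 * n)\<close>, so a large
  cross sum forces a large sum of the exponents whose exponentials have mean 1; the Chernoff bound
  then applies with c = 1.\<close>

lemma self_normalized_tail:
  fixes G H :: "'i \<Rightarrow> 'a \<Rightarrow> real"
  assumes fin: "finite I" and "I \<noteq> {}"
    and ind: "indep_vars (\<lambda>_. borel \<Otimes>\<^sub>M borel) (\<lambda>i \<omega>. (G i \<omega>, H i \<omega>)) I"
    and ind_GH: "\<And>i. i \<in> I \<Longrightarrow> indep_var borel (H i) borel (G i)"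
    and std_G: "\<And>i. i \<in> I \<Longrightarrow> distr M borel (G i) = std_normal_distribution"
    and std_H: "\<And>i. i \<in> I \<Longrightarrow> distr M borel (H i) = std_normal_distribution"
    and "t \<ge> 0"
  shows "prob {\<omega> \<in> space M. t \<le> (\<Sum>i\<in>I. H i \<omega> * G i \<omega>) \<and> (\<Sum>i\<in>I. (G i \<omega>)\<^sup>2) \<le> 3 / 2 * card I}
    \<le> exp (- t\<^sup>2 / (3 * card I))"
proof -
  define n where "n = real (card I)"
  have n: "n > 0" using assms by (simp add: n_def card_gt_0_iff)
  \<comment> \<open>The maximiser of \<open>l * t - 3 * n * l^2 / 4\<close>; the maximum is
    \<open>t^2 / (3 * n)\<close>.\<close>
  define l where "l = 2 * t / (3 * n)"
  have [measurable]: "random_variable borel (G i)" "random_variable borel (H i)" if "i \<in> I" for i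
    using ind_GH[OF that] by (auto dest: indep_var_rv1 indep_var_rv2)
  have ind': "indep_vars (\<lambda>_. borel) (\<lambda>i \<omega>. l * (H i \<omega> * G i \<omega>) - l\<^sup>2 / 2 * (G i \<omega>)\<^sup>2) I"
    using indep_vars_compose2[OF ind, of "\<lambda>_ (g, h). l * (h * g) - l\<^sup>2 / 2 * g\<^sup>2" "\<lambda>_. borel"]
    by simp
  have "prob {\<omega> \<in> space M. t \<le> (\<Sum>i\<in>I. H i \<omega> * G i \<omega>) \<and> (\<Sum>i\<in>I. (G i \<omega>)\<^sup>2) \<le> 3 / 2 * card I} \<le>
      prob {\<omega> \<in> space M. t\<^sup>2 / (3 * n) \<le> (\<Sum>i\<in>I. l * (H i \<omega> * G i \<omega>) - l\<^sup>2 / 2 * (G i \<omega>)\<^sup>2)}"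
  proof (rule finite_measure_mono, safe)
    fix \<omega> assume *: "t \<le> (\<Sum>i\<in>I. H i \<omega> * G i \<omega>)" "(\<Sum>i\<in>I. (G i \<omega>)\<^sup>2) \<le> 3 / 2 * card I"
    have "t\<^sup>2 / (3 * n) = l * t - l\<^sup>2 / 2 * (3 / 2 * n)"
      using n by (simp add: l_def field_simps power2_eq_square)
    also have "\<dots> \<le> l * (\<Sum>i\<in>I. H i \<omega> * G i \<omega>) - l\<^sup>2 / 2 * (\<Sum>i\<in>I. (G i \<omega>)\<^sup>2)"
      using * \<open>t \<ge> 0\<close> n by (intro diff_mono mult_left_mono) (auto simp: l_def n_def)
    finally show "t\<^sup>2 / (3 * n) \<le> (\<Sum>i\<in>I. l * (H i \<omega> * G i \<omega>) - l\<^sup>2 / 2 * (G i \<omega>)\<^sup>2)"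
      by (simp add: sum_subtractf sum_distrib_left)
  qed measurable
  also have "\<dots> \<le> 1 ^ card I * exp (- (t\<^sup>2 / (3 * n)))"
    using std_normal_pair_exp[OF ind_GH std_G std_H] by (intro chernoff_sum fin ind') auto
  finally show ?thesis by (simp add: n_def)
qed

text \<open>Each pair is a function of its own group of indices, and the groups are disjoint. Pairs
  are kept together because the cross term of an experiment depends on both entries.\<close>

lemma indep_vars_sum_pairs:
  fixes X :: "'k \<Rightarrow> 'a \<Rightarrow> real"
  assumes ind: "indep_vars (\<lambda>_. borel) X J"
    and sub: "\<And>i. i \<in> I \<Longrightarrow> insert (h i) (K i) \<subseteq> J"
    and disj: "disjoint_family_on (\<lambda>i. insert (h i) (K i)) I"
  shows "indep_vars (\<lambda>_. borel \<Otimes>\<^sub>M borel) (\<lambda>i \<omega>. (\<Sum>k\<in>K i. X k \<omega>, X (h i) \<omega>)) I"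
proof -
  have "indep_vars (\<lambda>_. borel \<Otimes>\<^sub>M borel)
      (\<lambda>i \<omega>. (\<lambda>f. (\<Sum>k\<in>K i. f k, f (h i))) (restrict (\<lambda>k. X k \<omega>) (insert (h i) (K i)))) I"
    by (rule indep_vars_compose2[OF indep_vars_restrict[OF ind sub disj]])
      (auto intro!: measurable_Pair borel_measurable_sum measurable_component_singleton)
  then show ?thesis
    by (rule indep_vars_cong[THEN iffD1, rotated -1]) (auto intro!: ext sum.cong)
qed

end

section \<open>Nets and bilinear forms\<close>

text \<open>Covers both the Euclidean norm and the square root of a positive definite form.
  Comparison with the Euclidean norm supplies continuity, compact spheres and bounded balls; the
  constants \<open>c\<close> and \<open>C\<close> do not appear in the size of a net.\<close>

locale equivalent_norm =
  fixes p :: "'a::euclidean_space \<Rightarrow> real" and c C :: real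
  assumes triangle: "p (v + w) \<le> p v + p w"
    and scale: "p (r *\<^sub>R v) = \<bar>r\<bar> * p v"
    and c_pos: "c > 0" and lower: "c * norm v \<le> p v" and upper: "p v \<le> C * norm v"
begin

lemma nonneg: "p v \<ge> 0"
  using lower[of v] c_pos by (meson order_trans mult_nonneg_nonneg less_imp_le norm_ge_zero)

lemma minus_commute: "p (v - w) = p (w - v)"
  using scale[of "-1" "v - w"] by simp

lemma zero [simp]: "p 0 = 0"
  using scale[of 0 0] by simp

lemma pos: "v \<noteq> 0 \<Longrightarrow> p v > 0"
  using lower[of v] c_pos by (meson less_le_trans mult_pos_pos zero_less_norm_iff)

lemma C_pos: "C > 0"
proof -
  obtain b :: 'a where "b \<in> Basis" using nonempty_Basis by blast
  then show ?thesis using pos[of b] upper[of b] by (auto simp: nonzero_Basis)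
qed

lemma continuous: "continuous_on S p"
proof (rule continuous_onI)
  fix v :: 'a and e :: real assume "e > 0"
  show "\<exists>d>0. \<forall>w\<in>S. dist w v < d \<longrightarrow> dist (p w) (p v) \<le> e"
  proof (intro exI conjI ballI impI)
    show "e / C > 0" using \<open>e > 0\<close> C_pos by simp
    fix w assume w: "dist w v < e / C"
    have "\<bar>p w - p v\<bar> \<le> p (w - v)"
      using triangle[of "w - v" v] triangle[of "v - w" w] by (simp add: minus_commute)
    also have "\<dots> \<le> C * dist w v" using upper by (simp add: dist_norm)
    also have "\<dots> \<le> e" using w C_pos by (simp add: field_simps)
    finally show "dist (p w) (p v) \<le> e" by (simp add: dist_real_def)
  qed
qed

lemma compact_sphere: "compact {v. p v = 1}"
proof -
  have "closed (p -` {1})"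
    using continuous[of UNIV] by (intro closed_vimage) (auto simp: continuous_on_eq_continuous_at)
  moreover have "bounded {v. p v = 1}"
  proof (rule boundedI)
    fix v assume "v \<in> {v. p v = 1}"
    then show "norm v \<le> 1 / c" using lower[of v] c_pos by (simp add: field_simps)
  qed
  ultimately show ?thesis by (simp add: compact_eq_bounded_closed vimage_def)
qed

lemma sphere_normalize: "v \<noteq> 0 \<Longrightarrow> p ((1 / p v) *\<^sub>R v) = 1"
  using pos[of v] by (simp add: scale)

lemma sphere_nonempty: "{v. p v = 1} \<noteq> {}"
proof -
  obtain b :: 'a where "b \<in> Basis" using nonempty_Basis by blast
  then show ?thesis using sphere_normalize[of b] by (auto simp: nonzero_Basis)
qed

text \<open>The balls of radius \<open>e / 2\<close> around the points of \<open>S\<close> are disjoint and lie in the ball of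
  radius \<open>1 + e / 2\<close>.\<close>

lemma separated_card_le:
  assumes "e > 0" and fin: "finite S" and S: "S \<subseteq> {v. p v = 1}"
    and sep: "\<And>v w. v \<in> S \<Longrightarrow> w \<in> S \<Longrightarrow> v \<noteq> w \<Longrightarrow> p (v - w) \<ge> e"
  shows "card S \<le> (1 + 2 / e) ^ DIM('a)"
proof -
  let ?d = "DIM('a)"
  let ?B = "{v. p v < 1}"
  \<comment> \<open>The ball of \<open>p\<close> of radius \<open>r\<close> around \<open>a\<close>,
    written as an affine image of the unit ball so that its volume is \<open>r ^ ?d\<close> times
    the volume of \<open>?B\<close>.\<close>
  let ?T = "\<lambda>r a. (\<lambda>v. r *\<^sub>R v + a) ` ?B"
  have T_iff: "x \<in> ?T r a \<longleftrightarrow> p (x - a) < r" if "r > 0" for r a x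
  proof
    assume "x \<in> ?T r a"
    then show "p (x - a) < r" using that by (auto simp: scale)
  next
    assume "p (x - a) < r"
    then have "p ((1 / r) *\<^sub>R (x - a)) < 1" using that by (simp add: scale)
    then show "x \<in> ?T r a"
      using that by (intro image_eqI[of _ _ "(1 / r) *\<^sub>R (x - a)"]) auto
  qed
  have "open (p -` {..<1})"
    using continuous[of UNIV] by (intro open_vimage) auto
  then have open_B: "open ?B" by (simp add: vimage_def)
  have bdd_B: "bounded ?B"
  proof (rule boundedI)
    fix v assume "v \<in> ?B"
    then show "norm v \<le> 1 / c" using lower[of v] c_pos by (simp add: field_simps)
  qed
  have "0 \<in> ?B" by simp
  \<comment> \<open>A nonempty open set has positive volume, so the volume of \<open>?B\<close> can
    be cancelled from the final comparison.\<close>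
  then have measure_pos: "measure lebesgue ?B > 0"
    using open_not_negligible[OF open_B] negligible_iff_measure0[OF lmeasurable_open[OF bdd_B open_B]]
    using \<open>0 \<in> ?B\<close> by (metis empty_iff measure_nonneg order_le_less)
  have open_T: "open (?T r a)" if "r > 0" for r a
    using open_affinity[OF open_B, of r a] that by (simp add: add.commute)
  have bdd_T: "bounded (?T r a)" if "r > 0" for r a
    using bounded_translation[OF bounded_scaling[OF bdd_B, of r], of a]
    by (simp add: image_image add.commute)
  have lm: "?T r a \<in> lmeasurable" if "r > 0" for r a
    using open_T[OF that] bdd_T[OF that] by (intro lmeasurable_open)
  have disj: "disjoint_family_on (?T (e / 2)) S"
  proof (unfold disjoint_family_on_def, intro ballI impI)
    fix v w assume vw: "v \<in> S" "w \<in> S" "v \<noteq> w"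
    show "?T (e / 2) v \<inter> ?T (e / 2) w = {}"
    proof (rule ccontr)
      assume "?T (e / 2) v \<inter> ?T (e / 2) w \<noteq> {}"
      then obtain x where "x \<in> ?T (e / 2) v" "x \<in> ?T (e / 2) w" by blast
      then have "p (x - v) < e / 2" "p (x - w) < e / 2"
        using T_iff \<open>e > 0\<close> by simp_all
      moreover have "p (v - w) \<le> p (v - x) + p (x - w)"
        using triangle[of "v - x" "x - w"] by simp
      ultimately show False using sep[OF vw] by (simp add: minus_commute)
    qed
  qed
  have sub: "(\<Union>v\<in>S. ?T (e / 2) v) \<subseteq> ?T (1 + e / 2) 0"
  proof (rule UN_least, rule subsetI)
    fix v x assume "v \<in> S" "x \<in> ?T (e / 2) v"
    then have "p (x - v) < e / 2" "p v = 1" using T_iff[of "e / 2" x v] \<open>e > 0\<close> S by auto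
    then have "p (x - 0) < 1 + e / 2" using triangle[of "x - v" v] by simp
    then show "x \<in> ?T (1 + e / 2) 0" using T_iff[of "1 + e / 2" x 0] \<open>e > 0\<close> by auto
  qed
  have "card S * ((e / 2) ^ ?d * measure lebesgue ?B) = (\<Sum>v\<in>S. measure lebesgue (?T (e / 2) v))"
    using \<open>e > 0\<close> by (simp add: measure_lebesgue_affine)
  also have "\<dots> = measure lebesgue (\<Union>v\<in>S. ?T (e / 2) v)"
  proof (rule measure_finite_Union[symmetric, OF fin _ disj])
    show "?T (e / 2) ` S \<subseteq> sets lebesgue"
      using lm[of "e / 2"] \<open>e > 0\<close> by (intro image_subsetI fmeasurableD) simp
    show "emeasure lebesgue (?T (e / 2) v) \<noteq> \<infinity>" for v
      using fmeasurableD2[OF lm[of "e / 2" v]] \<open>e > 0\<close> by simp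
  qed
  also have "\<dots> \<le> measure lebesgue (?T (1 + e / 2) 0)"
  proof (rule measure_mono_fmeasurable[OF sub])
    show "(\<Union>v\<in>S. ?T (e / 2) v) \<in> sets lebesgue"
      using lm[of "e / 2"] \<open>e > 0\<close> fin by (intro sets.finite_UN fmeasurableD) simp_all
    show "?T (1 + e / 2) 0 \<in> lmeasurable"
      using lm[of "1 + e / 2" 0] \<open>e > 0\<close> by simp
  qed
  also have "\<dots> = (1 + e / 2) ^ ?d * measure lebesgue ?B"
    using \<open>e > 0\<close> measure_lebesgue_affine[of "1 + e / 2" 0 ?B] by simp
  finally have "card S * (e / 2) ^ ?d \<le> (1 + e / 2) ^ ?d"
    using measure_pos by simp
  then have "card S \<le> ((1 + e / 2) / (e / 2)) ^ ?d"
    using \<open>e > 0\<close> unfolding power_divide[of "1 + e / 2"] by (subst pos_le_divide_eq) simp_all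
  also have "(1 + e / 2) / (e / 2) = 1 + 2 / e"
    using \<open>e > 0\<close> by (simp add: field_simps)
  finally show ?thesis .
qed

text \<open>A separated set of greatest cardinality is a net: a point farther than \<open>e\<close>
  from all its members could be added to it. The packing bound guarantees that a greatest
  cardinality exists.\<close>

lemma exists_net:
  assumes "e > 0"
  obtains S where "finite S" "S \<subseteq> {v. p v = 1}" "card S \<le> (1 + 2 / e) ^ DIM('a)"
    and "\<And>v. p v = 1 \<Longrightarrow> \<exists>w\<in>S. p (v - w) \<le> e"
proof -
  define P where "P S \<longleftrightarrow> finite S \<and> S \<subseteq> {v. p v = 1} \<and>
    (\<forall>v\<in>S. \<forall>w\<in>S. v \<noteq> w \<longrightarrow> p (v - w) \<ge> e)" for S
  have bound: "card S \<le> (1 + 2 / e) ^ DIM('a)" if "P S" for S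
    using that \<open>e > 0\<close> by (intro separated_card_le) (auto simp: P_def)
  have "\<forall>S. P S \<longrightarrow> card S < Suc (nat \<lfloor>(1 + 2 / e) ^ DIM('a)\<rfloor>)"
    using bound by (auto simp: less_Suc_eq_le le_nat_floor)
  moreover have "P {}" by (simp add: P_def)
  ultimately obtain S where S: "P S" "\<And>S'. P S' \<Longrightarrow> card S' \<le> card S"
    using ex_has_greatest_nat[of P "{}" card] by blast
  show ?thesis
  proof
    show "finite S" "S \<subseteq> {v. p v = 1}" using S by (auto simp: P_def)
    show "card S \<le> (1 + 2 / e) ^ DIM('a)" using bound S by blast
    fix v assume v: "p v = 1"
    show "\<exists>w\<in>S. p (v - w) \<le> e"
    proof (rule ccontr)
      assume *: "\<not> (\<exists>w\<in>S. p (v - w) \<le> e)"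
      then have "v \<notin> S" using \<open>e > 0\<close> by force
      moreover have "P (insert v S)"
        using * S v by (auto simp: P_def minus_commute[of _ v] not_le less_imp_le)
      ultimately show False using S(2)[of "insert v S"] S(1) by (simp add: P_def)
    qed
  qed
qed

end

lemma equivalent_norm_norm: "equivalent_norm (norm :: 'a::euclidean_space \<Rightarrow> real) 1 1"
  by unfold_locales (auto simp: norm_triangle_ineq)

text \<open>At a maximiser, splitting off the nearest net points costs at most twice 1/8 of the maximum.\<close>

lemma bilinear_net_bound:
  fixes B :: "'a::euclidean_space \<Rightarrow> 'b::euclidean_space \<Rightarrow> real"
  assumes p: "equivalent_norm p c C" and q: "equivalent_norm q c' C'"
    and B: "bilinear B"
    and U: "U \<subseteq> {v. p v = 1}" "\<And>v. p v = 1 \<Longrightarrow> \<exists>v'\<in>U. p (v - v') \<le> 1 / 8"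
    and V: "V \<subseteq> {w. q w = 1}" "\<And>w. q w = 1 \<Longrightarrow> \<exists>w'\<in>V. q (w - w') \<le> 1 / 8"
    and bound: "\<And>v w. v \<in> U \<Longrightarrow> w \<in> V \<Longrightarrow> B v w \<le> t"
  shows "B v w \<le> 4 / 3 * t * p v * q w"
proof -
  interpret p: equivalent_norm p c C by fact
  interpret q: equivalent_norm q c' C' by fact
  interpret B: bounded_bilinear B using B by (simp add: bilinear_conv_bounded_bilinear)
  let ?S = "{v. p v = 1} \<times> {w. q w = 1}"
  have "compact ?S" by (intro compact_Times p.compact_sphere q.compact_sphere)
  moreover have "?S \<noteq> {}" using p.sphere_nonempty q.sphere_nonempty by auto
  moreover have "continuous_on ?S (\<lambda>z. B (fst z) (snd z))"
    by (intro B.continuous_on continuous_intros)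
  ultimately obtain z where "z \<in> ?S" and max: "\<forall>z'\<in>?S. B (fst z') (snd z') \<le> B (fst z) (snd z)"
    using continuous_attains_sup by blast
  then obtain v0 w0 where z: "z = (v0, w0)" "p v0 = 1" "q w0 = 1" by auto
  define K where "K = B v0 w0"
  have unit: "B v w \<le> K" if "p v = 1" "q w = 1" for v w
    using max that z by (force simp: K_def)
  \<comment> \<open>Reversing the sign of one argument shows that the maximum is nonnegative, so
    one-sided bounds at the net points suffice.\<close>
  have "B (- v0) w0 \<le> K" using z p.scale[of "-1" v0] by (intro unit) auto
  then have "K \<ge> 0" by (simp add: K_def B.minus_left)
  have gen: "B v w \<le> K * (p v * q w)" for v w
  proof (cases "v = 0 \<or> w = 0")
    case True
    then show ?thesis by (auto simp: B.zero_left B.zero_right)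
  next
    case False
    then have pos: "p v > 0" "q w > 0" using p.pos q.pos by auto
    have "B ((1 / p v) *\<^sub>R v) ((1 / q w) *\<^sub>R w) \<le> K"
      using False by (intro unit p.sphere_normalize q.sphere_normalize) auto
    then show ?thesis using pos by (simp add: B.scaleR_left B.scaleR_right field_simps)
  qed
  obtain v1 where v1: "v1 \<in> U" "p (v0 - v1) \<le> 1 / 8" using U z by blast
  obtain w1 where w1: "w1 \<in> V" "q (w0 - w1) \<le> 1 / 8" using V z by blast
  have "K = B (v0 - v1) w0 + B v1 (w0 - w1) + B v1 w1"
    by (simp add: K_def B.diff_left B.diff_right)
  also have "\<dots> \<le> K * (p (v0 - v1) * q w0) + K * (p v1 * q (w0 - w1)) + t"
    by (intro add_mono gen bound v1 w1)
  also have "\<dots> \<le> K * (1 / 8) + K * (1 / 8) + t"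
    using v1 w1 z U \<open>K \<ge> 0\<close> by (intro add_mono mult_left_mono) auto
  finally have "K \<le> 4 / 3 * t" by simp
  then have "K * (p v * q w) \<le> 4 / 3 * t * (p v * q w)"
    by (intro mult_right_mono mult_nonneg_nonneg p.nonneg q.nonneg)
  with gen[of v w] show ?thesis by simp
qed

section \<open>Positive definite forms as norms, and quadratic forms on their nets\<close>

lemma bilinear_Cauchy_Schwarz:
  fixes Q :: "'a::euclidean_space \<Rightarrow> 'a \<Rightarrow> real"
  assumes Q: "bilinear Q" and sym: "\<And>v w. Q v w = Q w v"
    and pos: "\<And>v. v \<noteq> 0 \<Longrightarrow> Q v v > 0"
  shows "(Q v w)\<^sup>2 \<le> Q v v * Q w w"
proof (cases "w = 0")
  case True
  then show ?thesis using Q by (simp add: bilinear_rzero)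
next
  case False
  interpret Q: bounded_bilinear Q using Q by (simp add: bilinear_conv_bounded_bilinear)
  \<comment> \<open>Up to the factor \<open>Q w w\<close>, this is the part of \<open>v\<close> that
    is orthogonal to \<open>w\<close> with respect to \<open>Q\<close>; its form value is
    \<open>Q w w\<close> times the Gram determinant.\<close>
  let ?x = "Q w w *\<^sub>R v - Q v w *\<^sub>R w"
  have "0 \<le> Q ?x ?x" using pos[of ?x] by (cases "?x = 0") (auto simp: Q.zero_left)
  also have "Q ?x ?x = Q w w * (Q v v * Q w w - (Q v w)\<^sup>2)"
    by (simp add: Q.diff_left Q.diff_right Q.scaleR_left Q.scaleR_right sym[of w v]
        power2_eq_square algebra_simps)
  finally show ?thesis using pos[OF False] by (simp add: zero_le_mult_iff)
qed

text \<open>Cauchy-Schwarz gives the triangle inequality, coercivity the lower constant, and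
  boundedness of bilinear maps in finite dimension the upper one.\<close>

lemma equivalent_norm_sqrt:
  fixes Q :: "'a::euclidean_space \<Rightarrow> 'a \<Rightarrow> real"
  assumes Q: "bilinear Q" and sym: "\<And>v w. Q v w = Q w v"
    and "a > 0" and coercive: "\<And>v. a\<^sup>2 * (norm v)\<^sup>2 \<le> Q v v"
  shows "\<exists>C. equivalent_norm (\<lambda>v. sqrt (Q v v)) a C"
proof -
  interpret Q: bounded_bilinear Q using Q by (simp add: bilinear_conv_bounded_bilinear)
  have pos: "Q v v > 0" if "v \<noteq> 0" for v
    using coercive[of v] \<open>a > 0\<close> that
    by (meson less_le_trans mult_pos_pos zero_less_norm_iff zero_less_power)
  then have nonneg: "Q v v \<ge> 0" for v by (cases "v = 0") (auto simp: Q.zero_left less_imp_le)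
  obtain K where K: "\<And>v w. norm (Q v w) \<le> norm v * norm w * K" and "K \<ge> 0"
    using Q.nonneg_bounded by blast
  have "equivalent_norm (\<lambda>v. sqrt (Q v v)) a (sqrt K)"
  proof
    fix v w :: 'a and r :: real
    have "Q v w \<le> sqrt (Q v v * Q w w)"
      using bilinear_Cauchy_Schwarz[OF Q sym pos] by (intro real_le_rsqrt) auto
    then have "Q (v + w) (v + w) \<le> (sqrt (Q v v) + sqrt (Q w w))\<^sup>2"
      using nonneg
      by (simp add: Q.add_left Q.add_right sym[of w v] power2_sum real_sqrt_mult)
    then show "sqrt (Q (v + w) (v + w)) \<le> sqrt (Q v v) + sqrt (Q w w)"
      using nonneg by (intro real_le_lsqrt) auto
    show "sqrt (Q (r *\<^sub>R v) (r *\<^sub>R v)) = \<bar>r\<bar> * sqrt (Q v v)"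
      by (simp add: Q.scaleR_left Q.scaleR_right real_sqrt_mult flip: mult.assoc)
    show "a > 0" by fact
    show "a * norm v \<le> sqrt (Q v v)"
      using coercive[of v] by (intro real_le_rsqrt) (simp add: power_mult_distrib)
    have "Q v v \<le> (sqrt K * norm v)\<^sup>2"
      using K[of v v] \<open>K \<ge> 0\<close>
      unfolding power_mult_distrib by (simp add: power2_eq_square[of "norm v"] mult_ac)
    then show "sqrt (Q v v) \<le> sqrt K * norm v"
      using nonneg \<open>K \<ge> 0\<close> by (intro real_le_lsqrt) auto
  qed
  then show ?thesis by blast
qed

text \<open>Only diagonal values are bounded on the net, so the union bound runs over points and not
  over pairs. The difference between the maximiser and its net point is an off-diagonal value
  \<open>R x y\<close>; polarisation brings it back to diagonal values, which the maximum
  \<open>K\<close> controls.\<close>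

lemma quadratic_net_bound:
  fixes Q R :: "'a::euclidean_space \<Rightarrow> 'a \<Rightarrow> real"
  assumes p: "equivalent_norm (\<lambda>v. sqrt (Q v v)) a C"
    and Q: "bilinear Q" and sym: "\<And>v w. Q v w = Q w v"
    and R: "bilinear R" and R_sym: "\<And>v w. R v w = R w v"
    and U: "U \<subseteq> {v. sqrt (Q v v) = 1}"
      "\<And>v. sqrt (Q v v) = 1 \<Longrightarrow> \<exists>w\<in>U. sqrt (Q (v - w) (v - w)) \<le> 1 / 8"
    and bound: "\<And>v. v \<in> U \<Longrightarrow> \<bar>R v v\<bar> \<le> t"
  shows "\<bar>R v v\<bar> \<le> 4 / 3 * t * Q v v"
proof -
  interpret p: equivalent_norm "\<lambda>v. sqrt (Q v v)" a C by fact
  interpret Q: bounded_bilinear Q using Q by (simp add: bilinear_conv_bounded_bilinear)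
  interpret R: bounded_bilinear R using R by (simp add: bilinear_conv_bounded_bilinear)
  have nonneg: "Q v v \<ge> 0" for v using p.nonneg[of v] by simp
  let ?S = "{v. sqrt (Q v v) = 1}"
  have "continuous_on ?S (\<lambda>v. \<bar>R v v\<bar>)"
    by (intro continuous_intros R.continuous_on)
  then obtain v0 where v0: "Q v0 v0 = 1" and max: "\<And>v. Q v v = 1 \<Longrightarrow> \<bar>R v v\<bar> \<le> \<bar>R v0 v0\<bar>"
    using continuous_attains_sup[OF p.compact_sphere p.sphere_nonempty] by auto
  define K where "K = \<bar>R v0 v0\<bar>"
  have "K \<ge> 0" by (simp add: K_def)
  have gen: "\<bar>R v v\<bar> \<le> K * Q v v" for v
  proof (cases "v = 0")
    case True
    then show ?thesis by (simp add: R.zero_left Q.zero_left)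
  next
    case False
    then have pos: "Q v v > 0" using p.pos[of v] by simp
    define s where "s = sqrt (Q v v)"
    have s: "s > 0" "s\<^sup>2 = Q v v" using pos by (auto simp: s_def)
    have "Q ((1 / s) *\<^sub>R v) ((1 / s) *\<^sub>R v) = 1"
      using s pos by (simp add: Q.scaleR_left Q.scaleR_right power2_eq_square flip: s(2))
    from max[OF this] have "\<bar>R v v / s\<^sup>2\<bar> \<le> K"
      by (simp add: R.scaleR_left R.scaleR_right K_def power2_eq_square)
    then show ?thesis using pos unfolding s(2) by (simp add: field_simps)
  qed
  obtain w where w: "w \<in> U" "sqrt (Q (v0 - w) (v0 - w)) \<le> 1 / 8" using U(2) v0 by auto
  define x y where "x = v0 - w" and "y = v0 + w"
  have Qw: "Q w w = 1" using U(1) w(1) by auto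
  have Qx: "Q x x \<le> 1 / 64"
    using w(2) sqrt_le_D[of "Q (v0 - w) (v0 - w)" "1 / 8"] by (simp add: x_def power2_eq_square)
  have "Q x x + Q y y = 2 * Q v0 v0 + 2 * Q w w"
    by (simp add: x_def y_def Q.diff_left Q.diff_right Q.add_left Q.add_right)
  then have Qy: "Q y y \<le> 4" using nonneg[of x] v0 Qw by simp
  \<comment> \<open>The factors 4 and 1/4 balance the bounds on \<open>Q x x\<close> and \<open>Q y y\<close> in the polarisation identity.\<close>
  let ?s = "4 *\<^sub>R x + (1 / 4) *\<^sub>R y" and ?d = "4 *\<^sub>R x - (1 / 4) *\<^sub>R y"
  have "R v0 v0 - R w w = R x y"
    by (simp add: x_def y_def R.diff_left R.add_right R_sym[of w v0])
  also have "R x y = (R ?s ?s - R ?d ?d) / 4"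
    by (simp add: R.diff_left R.diff_right R.add_left R.add_right R.scaleR_left R.scaleR_right
        R_sym[of y x] field_simps)
  finally have diff: "R v0 v0 - R w w = (R ?s ?s - R ?d ?d) / 4" .
  have abs_diff: "\<bar>(b - b') / 4\<bar> \<le> (k + k') / 4" if "\<bar>b\<bar> \<le> k" "\<bar>b'\<bar> \<le> k'" for b b' k k' :: real
    using that by (simp add: abs_le_iff)
  have "\<bar>R v0 v0 - R w w\<bar> \<le> K * (Q ?s ?s + Q ?d ?d) / 4"
    unfolding diff distrib_left by (intro abs_diff gen)
  also have "Q ?s ?s + Q ?d ?d = 32 * Q x x + Q y y / 8"
    by (simp add: Q.diff_left Q.diff_right Q.add_left Q.add_right Q.scaleR_left Q.scaleR_right field_simps)
  \<comment> \<open>Since 32/64 + 4/8 = 1, passing to the net point costs at most a quarter of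
    \<open>K\<close>, which gives the factor 4/3.\<close>
  also have "K * (32 * Q x x + Q y y / 8) / 4 \<le> K * 1 / 4"
    using Qx Qy \<open>K \<ge> 0\<close> by (intro divide_right_mono mult_left_mono) auto
  finally have "K \<le> 4 / 3 * t" 
    using bound[OF w(1)] abs_triangle_ineq2[of "R v0 v0" "R w w"] unfolding K_def by linarith
  then have "K * Q v v \<le> 4 / 3 * t * Q v v"
    by (intro mult_right_mono nonneg)
  with gen[of v] show ?thesis by simp
qed

section \<open>State covariance and normal equations\<close>

text \<open>First-order optimality in algebraic form, for use with the Rayleigh quotient and with
  the least-squares loss: a step \<open>- a / k\<close> with \<open>k\<close> positive and above
  \<open>b\<close> makes the expression negative unless \<open>a = 0\<close>.\<close>

lemma linear_coeff_zero:
  fixes a b :: real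
  assumes "\<And>s. 0 \<le> a * s + b * s\<^sup>2"
  shows "a = 0"
proof (rule ccontr)
  assume "a \<noteq> 0"
  define k where "k = \<bar>b\<bar> + 1"
  have k: "k > 0" "b < k" by (auto simp: k_def)
  have "a * (- a / k) + b * (- a / k)\<^sup>2 = (a\<^sup>2 / k) * (b / k - 1)"
    using k by (simp add: field_simps power2_eq_square)
  moreover have "a\<^sup>2 / k > 0" "b / k - 1 < 0" using k \<open>a \<noteq> 0\<close> by auto
  ultimately have "a * (- a / k) + b * (- a / k)\<^sup>2 < 0"
    using mult_pos_neg by metis
  with assms[of "- a / k"] show False by simp
qed

lemma inner_matrix_vector: "v \<bullet> (D *v w) = (transpose D *v v) \<bullet> w"
  for D :: "real^'n^'m"
  by (simp add: transpose_matrix_vector dot_lmul_matrix)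

text \<open>Eigenvectors for distinct eigenvalues of a symmetric matrix are orthogonal, hence
  linearly independent. Finiteness gives \<open>Min\<close> in \<open>min_eigenvalue\<close> its
  meaning.\<close>

lemma finite_eigenvalues:
  fixes S :: "real^'n^'n"
  assumes sym: "\<And>v w. v \<bullet> (S *v w) = (S *v v) \<bullet> w"
  shows "finite (eigenvalues S)"
proof -
  have "\<forall>l\<in>eigenvalues S. \<exists>v. v \<noteq> 0 \<and> S *v v = l *\<^sub>R v" by (auto simp: eigenvalues_def)
  then obtain e where e: "\<And>l. l \<in> eigenvalues S \<Longrightarrow> e l \<noteq> 0 \<and> S *v e l = l *\<^sub>R e l"
    by metis
  have orth: "e l \<bullet> e m = 0" if "l \<in> eigenvalues S" "m \<in> eigenvalues S" "l \<noteq> m" for l m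
    using sym[of "e l" "e m"] e[OF that(1)] e[OF that(2)] that(3) by simp
  have inj: "inj_on e (eigenvalues S)"
    using orth e by (metis inj_onI inner_eq_zero_iff)
  have "pairwise orthogonal (e ` eigenvalues S)"
    using orth by (auto simp: pairwise_def orthogonal_def)
  moreover have "0 \<notin> e ` eigenvalues S" using e by force
  ultimately have "independent (e ` eigenvalues S)"
    by (intro pairwise_orthogonal_independent) auto
  then have "finite (e ` eigenvalues S)" by (rule finiteI_independent)
  then show ?thesis using inj by (rule finite_imageD)
qed

text \<open>The quadratic form attains its minimum on the compact unit sphere. Perturbing the
  minimiser \<open>v0\<close> in an arbitrary direction \<open>w\<close> shows that it is an
  eigenvector, and the minimum value bounds every eigenvalue from below.\<close>

lemma min_eigenvalue_rayleigh:
  fixes S :: "real^'n^'n"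
  assumes sym: "\<And>v w. v \<bullet> (S *v w) = (S *v v) \<bullet> w"
  shows "min_eigenvalue S * (norm v)\<^sup>2 \<le> v \<bullet> (S *v v)"
    and "min_eigenvalue S \<in> eigenvalues S"
proof -
  let ?f = "\<lambda>v. v \<bullet> (S *v v)"
  have "continuous_on (sphere 0 1) ?f"
    by (intro continuous_intros matrix_vector_mult_linear_continuous_on)
  moreover have "sphere (0 :: real^'n) 1 \<noteq> {}" by simp
  ultimately obtain v0 where "v0 \<in> sphere 0 1" and inf: "\<forall>v\<in>sphere 0 1. ?f v0 \<le> ?f v"
    using continuous_attains_inf[OF compact_sphere] by blast
  then have v0: "norm v0 = 1" by simp
  have min: "?f v0 \<le> ?f v" if "norm v = 1" for v
    using inf that by simp
  define l where "l = ?f v0"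
  have ray: "l * (norm v)\<^sup>2 \<le> ?f v" for v
  proof (cases "v = 0")
    case False
    then have "l \<le> ?f ((1 / norm v) *\<^sub>R v)" unfolding l_def by (intro min) simp
    also have "\<dots> = ?f v / (norm v)\<^sup>2"
      by (simp add: matrix_vector_mult_scaleR power2_eq_square)
    finally show ?thesis using False by (simp add: pos_le_divide_eq)
  qed simp
  have "w \<bullet> (S *v v0 - l *\<^sub>R v0) = 0" for w
  proof -
    have "2 * (w \<bullet> (S *v v0 - l *\<^sub>R v0)) = 0"
    proof (rule linear_coeff_zero)
      fix s :: real
      have "0 \<le> ?f (v0 + s *\<^sub>R w) - l * (norm (v0 + s *\<^sub>R w))\<^sup>2"
        using ray[of "v0 + s *\<^sub>R w"] by simp
      also have "\<dots> = (?f v0 - l * (norm v0)\<^sup>2) + 2 * (w \<bullet> (S *v v0 - l *\<^sub>R v0)) * s +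
          (?f w - l * (norm w)\<^sup>2) * s\<^sup>2"
        unfolding power2_norm_eq_inner
        using sym[of v0 w] inner_commute[of w "S *v v0"] inner_commute[of w v0]
        by (simp add: matrix_vector_right_distrib matrix_vector_mult_scaleR inner_add_left
            inner_add_right inner_diff_right algebra_simps power2_eq_square)
      also have "?f v0 - l * (norm v0)\<^sup>2 = 0" by (simp add: l_def v0)
      finally show "0 \<le> 2 * (w \<bullet> (S *v v0 - l *\<^sub>R v0)) * s + (?f w - l * (norm w)\<^sup>2) * s\<^sup>2"
        by simp
    qed
    then show ?thesis by simp
  qed
  then have "S *v v0 - l *\<^sub>R v0 = 0" using inner_eq_zero_iff by blast
  then have l_in: "l \<in> eigenvalues S" using v0 by (auto simp: eigenvalues_def intro!: exI[of _ v0])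
  have "l \<le> m" if "m \<in> eigenvalues S" for m
  proof -
    obtain v where v: "v \<noteq> 0" "S *v v = m *\<^sub>R v" using \<open>m \<in> eigenvalues S\<close> by (auto simp: eigenvalues_def)
    then have "l * (norm v)\<^sup>2 \<le> m * (norm v)\<^sup>2"
      using ray[of v] by (simp add: power2_norm_eq_inner)
    then show ?thesis using v by simp
  qed
  then have eq: "min_eigenvalue S = l"
    unfolding min_eigenvalue_def by (intro Min_eqI finite_eigenvalues sym l_in)
  show "min_eigenvalue S * (norm v)\<^sup>2 \<le> v \<bullet> (S *v v)" using ray by (simp add: eq)
  show "min_eigenvalue S \<in> eigenvalues S" using l_in by (simp add: eq)
qed

section \<open>The unrolled state and its covariance\<close>

lemma matpow_mult_commute: "matpow A t ** A = A ** matpow A t"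
  by (induction t) (auto simp: matrix_mul_assoc[symmetric] matrix_mul_lid matrix_mul_rid)

lemma matpow_Suc_vec: "matpow A t *v (A *v v) = matpow A (Suc t) *v v"
  by (simp add: matrix_vector_mul_assoc matpow_mult_commute)

lemma transpose_matpow: "transpose (matpow A t) = matpow (transpose A) t"
  by (induction t) (auto simp: matrix_transpose_mul transpose_mat matpow_mult_commute)

lemma sum_matrix_vector_mult: "(\<Sum>t\<in>I. D t) *v v = (\<Sum>t\<in>I. D t *v v)"
  for D :: "'i \<Rightarrow> real^'n^'m"
  by (induction I rule: infinite_finite_induct) (auto simp: matrix_vector_mult_add_rdistrib)

text \<open>Moving the left factors onto \<open>v\<close> exhibits a sum of Gram forms. Symmetry and
  positivity become visible, and the diagonal summands are the variances of the single noise terms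
  in the unrolled state.\<close>

lemma inner_state_covariance:
  fixes A :: "real^'n^'n" and B :: "real^'u^'n"
  shows "v \<bullet> (state_covariance A B \<sigma>w \<sigma>u T *v w) =
    \<sigma>u\<^sup>2 * (\<Sum>t<T. (transpose B *v (matpow (transpose A) t *v v)) \<bullet>
      (transpose B *v (matpow (transpose A) t *v w))) +
    \<sigma>w\<^sup>2 * (\<Sum>t<T. (matpow (transpose A) t *v v) \<bullet> (matpow (transpose A) t *v w))"
proof -
  have "v \<bullet> ((matpow A t ** D) *v w) = (matpow (transpose A) t *v v) \<bullet> (D *v w)"
    for t and D :: "real^'n^'n"
    by (simp add: matrix_vector_mul_assoc[symmetric] inner_matrix_vector transpose_matpow)
  moreover have "v \<bullet> ((matpow A t ** B ** transpose B ** D) *v w) =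
      (transpose B *v (matpow (transpose A) t *v v)) \<bullet> (transpose B *v (D *v w))"
    for t and D :: "real^'n^'n"
    by (simp add: matrix_vector_mul_assoc[symmetric] inner_matrix_vector transpose_matpow)
  ultimately show ?thesis
    by (simp add: state_covariance_def matrix_vector_mult_add_rdistrib inner_add_right
        scaleR_matrix_vector_assoc[symmetric] sum_matrix_vector_mult inner_sum_right)
qed

text \<open>One step of the recursion replaces \<open>v\<close> by \<open>transpose A *v v\<close>,
  hence the induction with \<open>v\<close> arbitrary.\<close>

lemma inner_state:
  fixes A :: "real^'n^'n" and B :: "real^'u^'n"
  assumes "x 0 = 0" and "\<And>t. t < k \<Longrightarrow> x (Suc t) = A *v x t + B *v u t + w t"
  shows "v \<bullet> x k = (\<Sum>t<k. (transpose B *v (matpow (transpose A) (k - Suc t) *v v)) \<bullet> u t +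
    (matpow (transpose A) (k - Suc t) *v v) \<bullet> w t)"
  using assms(2)
proof (induction k arbitrary: v)
  case 0
  then show ?case by (simp add: assms(1))
next
  case (Suc k)
  have "v \<bullet> x (Suc k) = (transpose A *v v) \<bullet> x k + (transpose B *v v) \<bullet> u k + v \<bullet> w k"
    using Suc.prems[of k] by (simp add: inner_add_right inner_matrix_vector
      del: transpose_matrix_vector)
  also have "(transpose A *v v) \<bullet> x k =
      (\<Sum>t<k. (transpose B *v (matpow (transpose A) (Suc k - Suc t) *v v)) \<bullet> u t +
        (matpow (transpose A) (Suc k - Suc t) *v v) \<bullet> w t)"
    using Suc by (simp add: matpow_Suc_vec Suc_diff_Suc del: matpow.simps(2) transpose_matrix_vector)
  finally show ?case by simp
qed

section \<open>Error matrices and the least-squares minimiser\<close>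

text \<open>The squared norm of \<open>D *v v\<close> is the inner product of
  \<open>transpose D *v (D *v v)\<close> with \<open>v\<close>. Control of the row combinations of
  an error matrix along unit vectors \<open>b\<close> thereby becomes a bound on its spectral
  norm.\<close>

lemma spectral_norm_le_transpose:
  fixes D :: "real^'n^'m"
  assumes K: "\<And>b. norm b = 1 \<Longrightarrow> norm (transpose D *v b) \<le> K"
  shows "spectral_norm D \<le> K"
  unfolding spectral_norm_def
proof (rule onorm_le)
  fix v
  have gen: "norm (transpose D *v b) \<le> K * norm b" for b
  proof (cases "b = 0")
    case False
    then have "norm (transpose D *v ((1 / norm b) *\<^sub>R b)) \<le> K" by (intro K) simp
    then show ?thesis using False by (simp add: matrix_vector_mult_scaleR field_simps)
  qed simp
  have "(norm (D *v v))\<^sup>2 = (transpose D *v (D *v v)) \<bullet> v"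
    by (simp add: power2_norm_eq_inner inner_matrix_vector)
  also have "\<dots> \<le> norm (transpose D *v (D *v v)) * norm v" by (rule norm_cauchy_schwarz)
  also have "\<dots> \<le> K * norm (D *v v) * norm v" by (intro mult_right_mono gen) simp
  finally have "norm (D *v v) * norm (D *v v) \<le> (K * norm v) * norm (D *v v)"
    by (simp add: power2_eq_square mult_ac)
  moreover have "0 \<le> K * norm v"
  proof -
    \<comment> \<open>A unit vector exists, so \<open>K\<close> dominates some norm; this settles
      the case \<open>D *v v = 0\<close>.\<close>
    have "0 \<le> K" using K[of "axis undefined 1"] norm_ge_zero order_trans by (metis norm_axis_1)
    then show ?thesis by simp
  qed
  ultimately show "norm (D *v v) \<le> K * norm v"
    by (cases "D *v v = 0") auto
qed

text \<open>The minimiser is perturbed along a rank-one direction that moves the i-th residual by a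
  multiple \<open>s * y b i\<close> of \<open>b\<close>. The loss is then quadratic in
  \<open>s\<close>, and its linear coefficient must vanish. This holds for every minimiser, unique
  or not.\<close>

lemma least_squares_normal_equation:
  fixes A A' :: "real^'n^'n" and B B' :: "real^'u^'n"
  assumes min: "is_arg_min (ls_loss N T x u) (\<lambda>_. True) (A', B')"
    and step: "\<And>i. i \<in> {1..N} \<Longrightarrow> x i (Suc T) = A *v x i T + B *v u i T + w i"
  defines "y \<equiv> \<lambda>b i. (transpose (A' - A) *v b) \<bullet> x i T + (transpose (B' - B) *v b) \<bullet> u i T"
  shows "(\<Sum>i\<in>{1..N}. (y b i)\<^sup>2) = (\<Sum>i\<in>{1..N}. (b \<bullet> w i) * y b i)"
proof -
  let ?a = "transpose (A' - A) *v b" and ?c = "transpose (B' - B) *v b"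
  \<comment> \<open>The outer products of \<open>b\<close> with the two row combinations of the
    error; along this direction the derivative of the loss contains \<open>y\<close> itself, which
    produces its square in the result.\<close>
  define Da Db where "Da = (\<chi> j k. b $ j * ?a $ k)" and "Db = (\<chi> j k. b $ j * ?c $ k)"
  have Da: "Da *v v = (?a \<bullet> v) *\<^sub>R b" for v
    by (simp add: Da_def vec_eq_iff matrix_vector_mult_def inner_vec_def sum_distrib_left
        sum_distrib_right mult_ac)
  have Db: "Db *v v = (?c \<bullet> v) *\<^sub>R b" for v
    by (simp add: Db_def vec_eq_iff matrix_vector_mult_def inner_vec_def sum_distrib_left
        sum_distrib_right mult_ac)
  define r where "r i = x i (Suc T) - A' *v x i T - B' *v u i T" for i
  have loss: "ls_loss N T x u (A' + s *\<^sub>R Da, B' + s *\<^sub>R Db) =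
      (\<Sum>i\<in>{1..N}. (norm (r i))\<^sup>2) + (- 2 * (\<Sum>i\<in>{1..N}. (b \<bullet> r i) * y b i)) * s +
      (\<Sum>i\<in>{1..N}. (y b i)\<^sup>2 * (norm b)\<^sup>2) * s\<^sup>2" for s
  proof -
    have "(norm (x i (Suc T) - (A' + s *\<^sub>R Da) *v x i T - (B' + s *\<^sub>R Db) *v u i T))\<^sup>2 =
      (norm (r i))\<^sup>2 + - 2 * ((b \<bullet> r i) * y b i) * s + (y b i)\<^sup>2 * (norm b)\<^sup>2 * s\<^sup>2" for i
    proof -
      have eq: "x i (Suc T) - (A' + s *\<^sub>R Da) *v x i T - (B' + s *\<^sub>R Db) *v u i T = r i - (s * y b i) *\<^sub>R b"
        by (simp add: r_def y_def Da Db matrix_vector_mult_add_rdistrib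
            scaleR_matrix_vector_assoc[symmetric] scaleR_add_left distrib_left)
      then show ?thesis
        unfolding eq power2_norm_eq_inner using inner_commute[of b "r i"]
        by (simp add: inner_diff_left inner_diff_right power2_eq_square algebra_simps)
    qed
    then show ?thesis
      by (simp add: ls_loss_def sum.distrib sum_subtractf sum_distrib_left sum_distrib_right sum_negf mult_ac)
  qed
  have "- 2 * (\<Sum>i\<in>{1..N}. (b \<bullet> r i) * y b i) = 0"
  proof (rule linear_coeff_zero)
    fix s
    have "ls_loss N T x u (A' + 0 *\<^sub>R Da, B' + 0 *\<^sub>R Db) \<le> ls_loss N T x u (A' + s *\<^sub>R Da, B' + s *\<^sub>R Db)"
      using min by (auto simp: is_arg_min_linorder)
    then show "0 \<le> - 2 * (\<Sum>i\<in>{1..N}. (b \<bullet> r i) * y b i) * s + (\<Sum>i\<in>{1..N}. (y b i)\<^sup>2 * (norm b)\<^sup>2) * s\<^sup>2"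
      unfolding loss by simp
  qed
  moreover have "b \<bullet> r i = b \<bullet> w i - y b i" if "i \<in> {1..N}" for i
  proof -
    have "r i = w i - ((A' - A) *v x i T + (B' - B) *v u i T)"
      using step[OF that] by (simp add: r_def matrix_vector_mult_diff_rdistrib)
    then show ?thesis by (simp add: y_def inner_diff_right inner_add_right inner_matrix_vector)
  qed
  ultimately have "(\<Sum>i\<in>{1..N}. (b \<bullet> w i - y b i) * y b i) = 0" by simp
  then show ?thesis by (simp add: left_diff_distrib sum_subtractf power2_eq_square)
qed

section \<open>Concentration for the experiments\<close>

lemma inner_vimage_in_events_of:
  fixes d :: "'d::euclidean_space"
  assumes S: "S \<in> sets borel"
  shows "(\<lambda>\<omega>. d \<bullet> Y \<omega>) -` S \<inter> space M \<in> events_of M Y"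
proof -
  have "(\<lambda>y. d \<bullet> y) -` S \<inter> space borel \<in> sets borel"
    by (intro measurable_sets[OF _ S]) simp
  then show ?thesis
    unfolding events_of_def by (intro CollectI exI[of _ "(\<lambda>y. d \<bullet> y) -` S"]) auto
qed

text \<open>A projection generates a sub-sigma-algebra of the vector it projects, so independence
  survives. All projections are real-valued, hence \<open>indep_vars\<close> and its lemmas become
  available.\<close>

lemma (in prob_space) mutually_independent_inner:
  fixes w :: "nat \<Rightarrow> nat \<Rightarrow> 'a \<Rightarrow> real^'n" and u :: "nat \<Rightarrow> nat \<Rightarrow> 'a \<Rightarrow> real^'u"
  assumes "mutually_independent M I w u"
    and w: "\<And>i t. (i, t) \<in> I \<Longrightarrow> w i t \<in> borel_measurable M"
    and u: "\<And>i t. (i, t) \<in> I \<Longrightarrow> u i t \<in> borel_measurable M"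
  shows "indep_vars (\<lambda>_. borel)
    (case_sum (\<lambda>(i, t) \<omega>. a i t \<bullet> w i t \<omega>) (\<lambda>(i, t) \<omega>. c i t \<bullet> u i t \<omega>)) (I <+> I)"
  unfolding indep_vars_def2
proof (intro conjI ballI)
  fix k assume "k \<in> I <+> I"
  then show "random_variable borel
      (case_sum (\<lambda>(i, t) \<omega>. a i t \<bullet> w i t \<omega>) (\<lambda>(i, t) \<omega>. c i t \<bullet> u i t \<omega>) k)"
    using w u by (auto intro!: borel_measurable_inner)
next
  show "indep_sets (\<lambda>k. {case_sum (\<lambda>(i, t) \<omega>. a i t \<bullet> w i t \<omega>) (\<lambda>(i, t) \<omega>. c i t \<bullet> u i t \<omega>) k -` S \<inter> space M
      |S. S \<in> sets borel}) (I <+> I)"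
    by (rule indep_sets_mono_sets[OF assms(1)[unfolded mutually_independent_def]])
      (auto intro: inner_vimage_in_events_of)
qed

locale linear_experiments = prob_space M
  for M :: "'w measure" +
  fixes A :: "real^'n^'n" and B :: "real^'u^'n" and \<sigma>w \<sigma>u :: real and T N :: nat
    and x w :: "nat \<Rightarrow> nat \<Rightarrow> 'w \<Rightarrow> real^'n"
    and u :: "nat \<Rightarrow> nat \<Rightarrow> 'w \<Rightarrow> real^'u"
  assumes \<sigma>w: "\<sigma>w > 0" and \<sigma>u: "\<sigma>u > 0" and T: "T \<ge> 1" and N: "N > 0"
    and w_gauss: "\<And>i t. i \<in> {1..N} \<Longrightarrow> t \<le> T \<Longrightarrow>
          distributed M lborel (w i t) (\<lambda>v. ennreal (gaussian_density \<sigma>w v))"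
    and u_gauss: "\<And>i t. i \<in> {1..N} \<Longrightarrow> t \<le> T \<Longrightarrow>
          distributed M lborel (u i t) (\<lambda>v. ennreal (gaussian_density \<sigma>u v))"
    and indep: "mutually_independent M ({1..N} \<times> {..T}) w u"
    and x_init: "\<And>i \<omega>. i \<in> {1..N} \<Longrightarrow> \<omega> \<in> space M \<Longrightarrow> x i 0 \<omega> = 0"
    and x_step: "\<And>i t \<omega>. i \<in> {1..N} \<Longrightarrow> t \<le> T \<Longrightarrow> \<omega> \<in> space M \<Longrightarrow>
          x i (Suc t) \<omega> = A *v x i t \<omega> + B *v u i t \<omega> + w i t \<omega>"
begin

abbreviation "\<Sigma>x \<equiv> state_covariance A B \<sigma>w \<sigma>u T"

definition Q :: "(real^'n) \<times> (real^'u) \<Rightarrow> (real^'n) \<times> (real^'u) \<Rightarrow> real" where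
  "Q v v' = fst v \<bullet> (\<Sigma>x *v fst v') + \<sigma>u\<^sup>2 * (snd v \<bullet> snd v')"

definition z :: "nat \<Rightarrow> 'w \<Rightarrow> (real^'n) \<times> (real^'u)" where
  "z i \<omega> = (x i T \<omega>, u i T \<omega>)"

lemma covariance_sym: "v \<bullet> (\<Sigma>x *v v') = (\<Sigma>x *v v) \<bullet> v'"
  unfolding inner_commute[of "\<Sigma>x *v v" v'] inner_state_covariance by (simp add: inner_commute)

text \<open>The term t = 0 of the process-noise sum alone contributes \<open>\<sigma>w^2\<close>
  times the identity; \<open>T \<ge> 1\<close> ensures that it is present.\<close>

lemma covariance_lower: "\<sigma>w\<^sup>2 * (norm v)\<^sup>2 \<le> v \<bullet> (\<Sigma>x *v v)"
proof -
  have "(norm v)\<^sup>2 = (\<Sum>t\<in>{0}. (matpow (transpose A) t *v v) \<bullet> (matpow (transpose A) t *v v))"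
    by (simp add: power2_norm_eq_inner)
  also have "\<dots> \<le> (\<Sum>t<T. (matpow (transpose A) t *v v) \<bullet> (matpow (transpose A) t *v v))"
    using T by (intro sum_mono2) auto
  finally show ?thesis
    unfolding inner_state_covariance
    by (intro add_increasing mult_left_mono mult_nonneg_nonneg sum_nonneg) auto
qed

lemma min_eigenvalue_pos: "min_eigenvalue \<Sigma>x > 0"
proof -
  have "min_eigenvalue \<Sigma>x \<in> eigenvalues \<Sigma>x"
    by (intro min_eigenvalue_rayleigh covariance_sym)
  then obtain v where v: "v \<noteq> 0" "\<Sigma>x *v v = min_eigenvalue \<Sigma>x *\<^sub>R v"
    by (auto simp: eigenvalues_def)
  then have "\<sigma>w\<^sup>2 * (norm v)\<^sup>2 \<le> min_eigenvalue \<Sigma>x * (norm v)\<^sup>2"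
    using covariance_lower[of v] by (simp add: power2_norm_eq_inner)
  then have "\<sigma>w\<^sup>2 \<le> min_eigenvalue \<Sigma>x" using v by simp
  then show ?thesis using \<sigma>w by (meson less_le_trans zero_less_power)
qed

lemma Q_sym: "Q v v' = Q v' v"
  using covariance_sym[of "fst v" "fst v'"] by (simp add: Q_def inner_commute)

lemma bilinear_Q: "bilinear Q"
proof -
  have "linear (Q v)" for v
    by (rule linearI)
      (auto simp: Q_def matrix_vector_right_distrib matrix_vector_mult_scaleR inner_add_right algebra_simps)
  then show ?thesis using Q_sym by (simp add: bilinear_def)
qed

text \<open>The first two bounds later split a bound on sqrt Q into those for the two error
  matrices; the third is the coercivity that makes sqrt Q an equivalent norm.\<close>

lemma Q_lower:
  shows "min_eigenvalue \<Sigma>x * (norm (fst v))\<^sup>2 \<le> Q v v" and "\<sigma>u\<^sup>2 * (norm (snd v))\<^sup>2 \<le> Q v v"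
    and "(min \<sigma>w \<sigma>u)\<^sup>2 * (norm v)\<^sup>2 \<le> Q v v"
proof -
  have Q: "Q v v = fst v \<bullet> (\<Sigma>x *v fst v) + \<sigma>u\<^sup>2 * (norm (snd v))\<^sup>2"
    by (simp add: Q_def power2_norm_eq_inner)
  have nonneg: "0 \<le> \<sigma>w\<^sup>2 * (norm (fst v))\<^sup>2" by simp
  show "min_eigenvalue \<Sigma>x * (norm (fst v))\<^sup>2 \<le> Q v v"
    unfolding Q by (intro add_increasing2 min_eigenvalue_rayleigh covariance_sym) simp
  show "\<sigma>u\<^sup>2 * (norm (snd v))\<^sup>2 \<le> Q v v"
    unfolding Q using order_trans[OF nonneg covariance_lower[of "fst v"]] by simp
  have "(min \<sigma>w \<sigma>u)\<^sup>2 * (norm v)\<^sup>2 = (min \<sigma>w \<sigma>u)\<^sup>2 * (norm (fst v))\<^sup>2 + (min \<sigma>w \<sigma>u)\<^sup>2 * (norm (snd v))\<^sup>2"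
    by (simp add: norm_prod_def distrib_left)
  also have "\<dots> \<le> \<sigma>w\<^sup>2 * (norm (fst v))\<^sup>2 + \<sigma>u\<^sup>2 * (norm (snd v))\<^sup>2"
    using \<sigma>w \<sigma>u by (intro add_mono mult_right_mono power_mono) auto
  also have "\<dots> \<le> Q v v" unfolding Q using covariance_lower[of "fst v"] by simp
  finally show "(min \<sigma>w \<sigma>u)\<^sup>2 * (norm v)\<^sup>2 \<le> Q v v" .
qed

lemma noise_measurable:
  assumes "i \<in> {1..N}" "t \<le> T"
  shows "w i t \<in> borel_measurable M" "u i t \<in> borel_measurable M"
  using distributed_measurable[OF w_gauss[OF assms]] distributed_measurable[OF u_gauss[OF assms]]
  by simp_all

text \<open>\<open>v \<bullet> z i\<close> is the sum of the scalar noise terms indexed by \<open>block i\<close>; the index \<open>Inl (i, T)\<close>, which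
  is not in \<open>block i\<close>, carries the normalised last noise \<open>b \<bullet> w i T / \<sigma>w\<close>.\<close>

definition coeff_w :: "(real^'n) \<times> (real^'u) \<Rightarrow> real^'n \<Rightarrow> nat \<Rightarrow> real^'n" where
  "coeff_w v b t = (if t < T then matpow (transpose A) (T - Suc t) *v fst v else (1 / \<sigma>w) *\<^sub>R b)"

text \<open>Inputs before time \<open>T\<close> reach the state through powers of \<open>A\<close>
  and through \<open>B\<close>, while the last input is itself the second component of
  \<open>z\<close>.\<close>

definition coeff_u :: "(real^'n) \<times> (real^'u) \<Rightarrow> nat \<Rightarrow> real^'u" where
  "coeff_u v t = (if t < T then transpose B *v (matpow (transpose A) (T - Suc t) *v fst v) else snd v)"

definition noise ::
  "(real^'n) \<times> (real^'u) \<Rightarrow> real^'n \<Rightarrow> (nat \<times> nat) + (nat \<times> nat) \<Rightarrow> 'w \<Rightarrow> real" where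
  "noise v b = case_sum (\<lambda>(i, t) \<omega>. coeff_w v b t \<bullet> w i t \<omega>) (\<lambda>(i, t) \<omega>. coeff_u v t \<bullet> u i t \<omega>)"

text \<open>The ranges differ at the end: the last input belongs to \<open>z i\<close>, but the last
  noise acts only on the state at time \<open>Suc T\<close>.\<close>

definition block :: "nat \<Rightarrow> ((nat \<times> nat) + (nat \<times> nat)) set" where
  "block i = ({i} \<times> {..<T}) <+> ({i} \<times> {..T})"

lemma sum_block: "(\<Sum>k\<in>block i. f k) = (\<Sum>t<T. f (Inl (i, t)) + f (Inr (i, t))) + f (Inr (i, T))"
proof -
  have "block i = (\<lambda>t. Inl (i, t)) ` {..<T} \<union> (\<lambda>t. Inr (i, t)) ` {..T}"
    by (auto simp: block_def)
  then have "(\<Sum>k\<in>block i. f k) = (\<Sum>t<T. f (Inl (i, t))) + (\<Sum>t\<le>T. f (Inr (i, t)))"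
    by (simp, subst sum.union_disjoint) (auto simp: sum.reindex inj_on_def)
  then show ?thesis
    by (simp add: lessThan_Suc_atMost[symmetric] sum.distrib add.assoc del: lessThan_Suc_atMost)
qed

lemma inner_z_eq_noise:
  assumes "i \<in> {1..N}" "\<omega> \<in> space M"
  shows "v \<bullet> z i \<omega> = (\<Sum>k\<in>block i. noise v b k \<omega>)"
proof -
  have "fst v \<bullet> x i T \<omega> = (\<Sum>t<T. coeff_u v t \<bullet> u i t \<omega> + coeff_w v b t \<bullet> w i t \<omega>)"
    using assms
    by (subst inner_state[where A = A and B = B and w = "\<lambda>t. w i t \<omega>" and u = "\<lambda>t. u i t \<omega>"])
      (auto simp: x_init x_step coeff_u_def coeff_w_def)
  then show ?thesis
    by (simp add: z_def inner_prod_def sum_block noise_def coeff_u_def[of v T] add.commute)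
qed

text \<open>Identifies \<open>Q v v\<close> as the variance of \<open>v \<bullet> z i\<close>. The
  noise at time \<open>t\<close> carries the power \<open>T - Suc t\<close>, so time reversal
  matches the sum with the one in \<open>state_covariance\<close>.\<close>

lemma noise_variance:
  "(\<Sum>k\<in>block i. case_sum (\<lambda>(i, t). \<sigma>w\<^sup>2 * (norm (coeff_w v b t))\<^sup>2)
    (\<lambda>(i, t). \<sigma>u\<^sup>2 * (norm (coeff_u v t))\<^sup>2) k) = Q v v"
proof -
  define f where "f t = \<sigma>w\<^sup>2 * (norm (matpow (transpose A) t *v fst v))\<^sup>2 +
    \<sigma>u\<^sup>2 * (norm (transpose B *v (matpow (transpose A) t *v fst v)))\<^sup>2" for t
  have "(\<Sum>t<T. \<sigma>w\<^sup>2 * (norm (coeff_w v b t))\<^sup>2 + \<sigma>u\<^sup>2 * (norm (coeff_u v t))\<^sup>2) = (\<Sum>t<T. f (T - Suc t))"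
    by (intro sum.cong) (auto simp: f_def coeff_w_def coeff_u_def)
  also have "\<dots> = (\<Sum>t<T. f t)" by (rule sum.nat_diff_reindex)
  also have "\<dots> = fst v \<bullet> (\<Sigma>x *v fst v)"
    by (simp add: inner_state_covariance f_def sum.distrib sum_distrib_left power2_norm_eq_inner
        del: transpose_matrix_vector)
  finally show ?thesis
    by (simp add: sum_block Q_def coeff_u_def[of v T] power2_norm_eq_inner)
qed

lemma noise_indep: "indep_vars (\<lambda>_. borel) (noise v b) (({1..N} \<times> {..T}) <+> ({1..N} \<times> {..T}))"
  unfolding noise_def
  by (rule mutually_independent_inner[OF indep]) (auto intro: noise_measurable)

lemma noise_gaussian:
  assumes "k \<in> ({1..N} \<times> {..T}) <+> ({1..N} \<times> {..T})"
  shows "gaussian_rv (case_sum (\<lambda>(i, t). \<sigma>w\<^sup>2 * (norm (coeff_w v b t))\<^sup>2)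
    (\<lambda>(i, t). \<sigma>u\<^sup>2 * (norm (coeff_u v t))\<^sup>2) k) (noise v b k)"
  using assms \<sigma>w \<sigma>u
  by (auto simp: noise_def intro!: gaussian_vector_inner w_gauss u_gauss)

section \<open>Tail bounds for one fixed pair of normalised directions\<close>

context
  fixes v :: "(real^'n) \<times> (real^'u)" and b :: "real^'n"
  assumes v: "Q v v = 1" and b: "norm b = 1"
begin

text \<open>A sum of noise terms instead of \<open>v \<bullet> z i\<close>, because independence and
  Gaussianity are available for the noise terms; the two agree on \<open>space M\<close>, where the
  recursion for \<open>x\<close> holds.\<close>

definition "G i \<omega> = (\<Sum>k\<in>block i. noise v b k \<omega>)"
definition "H i = noise v b (Inl (i, T))"

lemma block_subset:
  "i \<in> {1..N} \<Longrightarrow> insert (Inl (i, T)) (block i) \<subseteq> ({1..N} \<times> {..T}) <+> ({1..N} \<times> {..T})"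
  by (auto simp: block_def)

lemma finite_block: "finite (block i)"
  by (simp add: block_def)

lemma GH_indep: "indep_vars (\<lambda>_. borel \<Otimes>\<^sub>M borel) (\<lambda>i \<omega>. (G i \<omega>, H i \<omega>)) {1..N}"
  unfolding G_def H_def
  by (rule indep_vars_sum_pairs[OF noise_indep block_subset])
    (auto simp: disjoint_family_on_def block_def)

lemma G_indep: "indep_vars (\<lambda>_. borel) G {1..N}"
  using indep_vars_compose2[OF GH_indep, of "\<lambda>_. fst" "\<lambda>_. borel"] by simp

lemma HG_indep: "i \<in> {1..N} \<Longrightarrow> indep_var borel (H i) borel (G i)"
  unfolding G_def H_def
  by (intro indep_vars_sum finite_block indep_vars_subset[OF noise_indep block_subset])
    (auto simp: block_def)

lemma G_std: "i \<in> {1..N} \<Longrightarrow> distr M borel (G i) = std_normal_distribution"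
proof (rule gaussian_rv_std)
  assume i: "i \<in> {1..N}"
  have "gaussian_rv (Q v v) (\<lambda>\<omega>. \<Sum>k\<in>block i. noise v b k \<omega>)"
    unfolding noise_variance[of v b i, symmetric] using block_subset[OF i]
    by (intro gaussian_rv_sum indep_vars_subset[OF noise_indep] noise_gaussian) auto
  then show "gaussian_rv 1 (G i)" by (simp add: v G_def[abs_def])
qed

lemma H_std: "i \<in> {1..N} \<Longrightarrow> distr M borel (H i) = std_normal_distribution"
proof (rule gaussian_rv_std)
  assume "i \<in> {1..N}"
  then have "Inl (i, T) \<in> ({1..N} \<times> {..T}) <+> ({1..N} \<times> {..T})" by auto
  then show "gaussian_rv 1 (H i)"
    using noise_gaussian[of "Inl (i, T)" v b] \<sigma>w
    by (auto simp: H_def coeff_w_def b power_divide)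
qed

lemma G_eq: "i \<in> {1..N} \<Longrightarrow> \<omega> \<in> space M \<Longrightarrow> G i \<omega> = v \<bullet> z i \<omega>"
  by (simp add: G_def inner_z_eq_noise[of i \<omega> v b])

lemma H_eq: "H i \<omega> = (b \<bullet> w i T \<omega>) / \<sigma>w"
  by (simp add: H_def noise_def coeff_w_def)

lemma energy_upper_tail:
  "prob {\<omega> \<in> space M. 3 / 2 * N \<le> (\<Sum>i\<in>{1..N}. (v \<bullet> z i \<omega>)\<^sup>2)} \<le> exp (- real N / 24)"
proof -
  have "{\<omega> \<in> space M. 3 / 2 * N \<le> (\<Sum>i\<in>{1..N}. (v \<bullet> z i \<omega>)\<^sup>2)} =
      {\<omega> \<in> space M. 3 / 2 * card {1..N} \<le> (\<Sum>i\<in>{1..N}. (G i \<omega>)\<^sup>2)}"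
    by (auto simp: G_eq)
  then show ?thesis using chi_square_upper[OF _ G_indep G_std] by simp
qed

lemma energy_lower_tail:
  "prob {\<omega> \<in> space M. (\<Sum>i\<in>{1..N}. (v \<bullet> z i \<omega>)\<^sup>2) \<le> 1 / 2 * N} \<le> exp (- real N / 24)"
proof -
  have "{\<omega> \<in> space M. (\<Sum>i\<in>{1..N}. (v \<bullet> z i \<omega>)\<^sup>2) \<le> 1 / 2 * N} =
      {\<omega> \<in> space M. (\<Sum>i\<in>{1..N}. (G i \<omega>)\<^sup>2) \<le> 1 / 2 * card {1..N}}"
    by (auto simp: G_eq)
  then show ?thesis using chi_square_lower[OF _ G_indep G_std] by simp
qed

lemma cross_tail:
  assumes "s \<ge> 0"
  shows "prob {\<omega> \<in> space M. \<sigma>w * s \<le> (\<Sum>i\<in>{1..N}. (b \<bullet> w i T \<omega>) * (v \<bullet> z i \<omega>)) \<and>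
    (\<Sum>i\<in>{1..N}. (v \<bullet> z i \<omega>)\<^sup>2) \<le> 3 / 2 * N} \<le> exp (- s\<^sup>2 / (3 * N))"
proof -
  have "\<sigma>w * s \<le> (\<Sum>i\<in>{1..N}. (b \<bullet> w i T \<omega>) * (v \<bullet> z i \<omega>)) \<longleftrightarrow>
      s \<le> (\<Sum>i\<in>{1..N}. H i \<omega> * G i \<omega>)" if "\<omega> \<in> space M" for \<omega>
  proof -
    have "(\<Sum>i\<in>{1..N}. (b \<bullet> w i T \<omega>) * (v \<bullet> z i \<omega>)) = \<sigma>w * (\<Sum>i\<in>{1..N}. H i \<omega> * G i \<omega>)"
      using \<sigma>w that by (auto simp: sum_distrib_left H_eq G_eq intro!: sum.cong)
    then show ?thesis using \<sigma>w by simp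
  qed
  moreover have "(\<Sum>i\<in>{1..N}. (v \<bullet> z i \<omega>)\<^sup>2) = (\<Sum>i\<in>{1..N}. (G i \<omega>)\<^sup>2)" if "\<omega> \<in> space M" for \<omega>
    using that by (auto simp: G_eq)
  ultimately have "{\<omega> \<in> space M. \<sigma>w * s \<le> (\<Sum>i\<in>{1..N}. (b \<bullet> w i T \<omega>) * (v \<bullet> z i \<omega>)) \<and>
      (\<Sum>i\<in>{1..N}. (v \<bullet> z i \<omega>)\<^sup>2) \<le> 3 / 2 * N} =
    {\<omega> \<in> space M. s \<le> (\<Sum>i\<in>{1..N}. H i \<omega> * G i \<omega>) \<and>
      (\<Sum>i\<in>{1..N}. (G i \<omega>)\<^sup>2) \<le> 3 / 2 * card {1..N}}"
    by (intro Collect_cong) auto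
  then show ?thesis
    using self_normalized_tail[OF _ _ GH_indep HG_indep G_std H_std \<open>s \<ge> 0\<close>] N by simp
qed

end

section \<open>The union bound over the nets and its consequence for the estimates\<close>

lemma state_measurable:
  assumes i: "i \<in> {1..N}" and "t \<le> Suc T"
  shows "x i t \<in> borel_measurable M"
  using assms(2)
proof (induction t)
  case 0
  then show ?case using x_init[OF i] by (subst measurable_cong[where g = "\<lambda>_. 0"]) auto
next
  case (Suc t)
  have mat: "(\<lambda>v. D *v v) \<in> borel_measurable borel" for D :: "real^'k^'m"
    by (intro borel_measurable_continuous_onI matrix_vector_mult_linear_continuous_on)
  have "(\<lambda>\<omega>. A *v x i t \<omega> + B *v u i t \<omega> + w i t \<omega>) \<in> borel_measurable M"
    using Suc noise_measurable[OF i]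
    by (intro borel_measurable_add measurable_compose[OF _ mat]) auto
  then show ?case
    using Suc.prems x_step[OF i] by (subst measurable_cong) auto
qed

lemma z_measurable: "i \<in> {1..N} \<Longrightarrow> z i \<in> borel_measurable M"
  using state_measurable[of i T] noise_measurable[of i T]
  by (simp add: z_def[abs_def] borel_measurable_Pair)

text \<open>Strict inequalities, since the tail events to be avoided are closed conditions. The
  cross bound carries no energy condition of its own because the upper energy bound at the same
  \<open>v\<close> is part of the event.\<close>

definition good_event :: "((real^'n) \<times> (real^'u)) set \<Rightarrow> (real^'n) set \<Rightarrow> real \<Rightarrow> 'w set" where
  "good_event V U s = {\<omega> \<in> space M. \<forall>v\<in>V.
     1 / 2 * N < (\<Sum>i\<in>{1..N}. (v \<bullet> z i \<omega>)\<^sup>2) \<and> (\<Sum>i\<in>{1..N}. (v \<bullet> z i \<omega>)\<^sup>2) < 3 / 2 * N \<and>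
     (\<forall>b\<in>U. (\<Sum>i\<in>{1..N}. (b \<bullet> w i T \<omega>) * (v \<bullet> z i \<omega>)) < \<sigma>w * s)}"

lemma quadratic_form_measurable:
  "(\<lambda>\<omega>. \<Sum>i\<in>{1..N}. (v \<bullet> z i \<omega>)\<^sup>2) \<in> borel_measurable M"
  "(\<lambda>\<omega>. \<Sum>i\<in>{1..N}. (b \<bullet> w i T \<omega>) * (v \<bullet> z i \<omega>)) \<in> borel_measurable M"
  using z_measurable noise_measurable[of _ T]
  by (auto intro!: borel_measurable_sum borel_measurable_power borel_measurable_times borel_measurable_inner)

lemma good_event_measurable:
  assumes "finite V" "finite U"
  shows "good_event V U s \<in> events"
proof -
  note [measurable] = quadratic_form_measurable
  show ?thesis unfolding good_event_def using assms by measurable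
qed

lemma prob_good_event:
  assumes V: "finite V" "V \<subseteq> {v. Q v v = 1}" and U: "finite U" "U \<subseteq> {b. norm b = 1}" and "s \<ge> 0"
  shows "prob (good_event V U s) \<ge>
    1 - (2 * card V * exp (- real N / 24) + card V * card U * exp (- s\<^sup>2 / (3 * N)))"
proof -
  note [measurable] = quadratic_form_measurable
  let ?E1 = "\<lambda>v. {\<omega> \<in> space M. 3 / 2 * N \<le> (\<Sum>i\<in>{1..N}. (v \<bullet> z i \<omega>)\<^sup>2)}"
  let ?E2 = "\<lambda>v. {\<omega> \<in> space M. (\<Sum>i\<in>{1..N}. (v \<bullet> z i \<omega>)\<^sup>2) \<le> 1 / 2 * N}"
  let ?E3 = "\<lambda>(v, b). {\<omega> \<in> space M. \<sigma>w * s \<le> (\<Sum>i\<in>{1..N}. (b \<bullet> w i T \<omega>) * (v \<bullet> z i \<omega>)) \<and>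
    (\<Sum>i\<in>{1..N}. (v \<bullet> z i \<omega>)\<^sup>2) \<le> 3 / 2 * N}"
  have meas: "?E1 v \<in> events" "?E2 v \<in> events" "?E3 p \<in> events" for v p
    unfolding split_beta by measurable
  have meas': "(\<Union>v\<in>V. ?E1 v) \<in> events" "(\<Union>v\<in>V. ?E2 v) \<in> events" "(\<Union>p\<in>V \<times> U. ?E3 p) \<in> events"
    using V U meas by (auto intro!: sets.finite_UN)
  have union_bound: "prob (\<Union>j\<in>J. F j) \<le> card J * e"
    if "finite J" "\<And>j. j \<in> J \<Longrightarrow> F j \<in> events" "\<And>j. j \<in> J \<Longrightarrow> prob (F j) \<le> e"
    for J :: "'j set" and F and e :: real
  proof -
    have "prob (\<Union>j\<in>J. F j) \<le> (\<Sum>j\<in>J. prob (F j))"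
      using that by (intro finite_measure_subadditive_finite) auto
    also have "\<dots> \<le> (\<Sum>j\<in>J. e)" using that by (intro sum_mono) auto
    finally show ?thesis by simp
  qed
  have "1 - prob (good_event V U s) = prob (space M - good_event V U s)"
    using V U by (simp add: prob_compl good_event_measurable)
  also have "\<dots> \<le> prob (((\<Union>v\<in>V. ?E1 v) \<union> (\<Union>v\<in>V. ?E2 v)) \<union> (\<Union>p\<in>V \<times> U. ?E3 p))"
  proof (rule finite_measure_mono)
    \<comment> \<open>A violated cross bound lies in \<open>?E3\<close> if the energy at that
      \<open>v\<close> is at most \<open>3 / 2 * N\<close>, and in \<open>?E1\<close>
      otherwise.\<close>
    show "space M - good_event V U s \<subseteq> ((\<Union>v\<in>V. ?E1 v) \<union> (\<Union>v\<in>V. ?E2 v)) \<union> (\<Union>p\<in>V \<times> U. ?E3 p)"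
      unfolding good_event_def by (auto simp: not_less) (meson linear not_le)+
  qed (intro sets.Un meas')
  also have "\<dots> \<le> prob ((\<Union>v\<in>V. ?E1 v) \<union> (\<Union>v\<in>V. ?E2 v)) + prob (\<Union>p\<in>V \<times> U. ?E3 p)"
    by (intro measure_Un_le sets.Un meas')
  also have "\<dots> \<le> prob (\<Union>v\<in>V. ?E1 v) + prob (\<Union>v\<in>V. ?E2 v) + prob (\<Union>p\<in>V \<times> U. ?E3 p)"
    by (intro add_right_mono measure_Un_le meas')
  also have "\<dots> \<le> card V * exp (- real N / 24) + card V * exp (- real N / 24) +
      card (V \<times> U) * exp (- s\<^sup>2 / (3 * N))"
  proof (intro add_mono union_bound meas)
    \<comment> \<open>The energy tails were proved for a pair of unit directions; any unit vector
      can fill the second place.\<close>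
    have e: "norm (axis undefined 1 :: real^'n) = 1" by simp
    fix v assume "v \<in> V"
    then have "Q v v = 1" using V(2) by blast
    then show "prob (?E1 v) \<le> exp (- real N / 24)" "prob (?E2 v) \<le> exp (- real N / 24)"
      by (rule energy_upper_tail[OF _ e], rule energy_lower_tail[OF _ e])
  next
    fix p assume "p \<in> V \<times> U"
    moreover obtain v b where p: "p = (v, b)" by (cases p)
    ultimately have "Q v v = 1" "norm b = 1" using V(2) U(2) by blast+
    from cross_tail[OF this \<open>s \<ge> 0\<close>] show "prob (?E3 p) \<le> exp (- s\<^sup>2 / (3 * N))"
      unfolding p prod.case .
  qed (use V(1) U(1) in simp_all)
  finally show ?thesis by (simp add: card_cartesian_product algebra_simps)
qed

text \<open>Purely deterministic: the good event speaks of noise and states only, so one event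
  serves all directions \<open>b\<close> and every choice of minimiser.\<close>

lemma estimation_error_bound:
  assumes V: "V \<subseteq> {v. Q v v = 1}" "\<And>v. Q v v = 1 \<Longrightarrow> \<exists>v'\<in>V. sqrt (Q (v - v') (v - v')) \<le> 1 / 8"
    and U: "U \<subseteq> {b. norm b = 1}" "\<And>b. norm b = 1 \<Longrightarrow> \<exists>b'\<in>U. norm (b - b') \<le> 1 / 8"
    and \<omega>: "\<omega> \<in> good_event V U s"
    and ls: "is_arg_min (ls_loss N T (\<lambda>i t. x i t \<omega>) (\<lambda>i t. u i t \<omega>)) (\<lambda>_. True) (A', B')"
    and b: "norm b = 1" and "s \<ge> 0"
  defines "\<theta> \<equiv> (transpose (A' - A) *v b, transpose (B' - B) *v b)"
  shows "sqrt (Q \<theta> \<theta>) \<le> 4 * \<sigma>w * s / N"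
proof -
  obtain C where p: "equivalent_norm (\<lambda>v. sqrt (Q v v)) (min \<sigma>w \<sigma>u) C"
    using equivalent_norm_sqrt[OF bilinear_Q Q_sym _ Q_lower(3)] \<sigma>w \<sigma>u by auto
  interpret p: equivalent_norm "\<lambda>v. sqrt (Q v v)" "min \<sigma>w \<sigma>u" C by fact
  define y where "y v i = v \<bullet> z i \<omega>" for v i
  \<comment> \<open>The deviation of the energy form from its mean \<open>N * Q\<close>. The net
    argument is applied to this symmetric form, which may be indefinite.\<close>
  define R where "R v v' = (\<Sum>i\<in>{1..N}. y v i * y v' i) - N * Q v v'" for v v'
  define D where "D b v = (\<Sum>i\<in>{1..N}. (b \<bullet> w i T \<omega>) * y v i)" for b v
  have good: "1 / 2 * N < (\<Sum>i\<in>{1..N}. (y v i)\<^sup>2)" "(\<Sum>i\<in>{1..N}. (y v i)\<^sup>2) < 3 / 2 * N"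
    "b \<in> U \<Longrightarrow> D b v < \<sigma>w * s" if "v \<in> V" for b v
    using \<omega> that by (auto simp: good_event_def y_def D_def)
  interpret Q: bounded_bilinear Q using bilinear_Q by (simp add: bilinear_conv_bounded_bilinear)
  have "bilinear R"
    unfolding bilinear_def
    by (intro conjI allI linearI)
      (auto simp: R_def y_def inner_add_left Q.add_left Q.add_right Q.scaleR_left Q.scaleR_right
        sum.distrib sum_distrib_left algebra_simps)
  moreover have "R v v' = R v' v" for v v' by (simp add: R_def Q_sym[of v v'] mult.commute)
  moreover have "\<bar>R v v\<bar> \<le> 1 / 2 * N" if "v \<in> V" for v
  proof -
    have "Q v v = 1" using V(1) that by auto
    then show ?thesis using good(1,2)[OF that] by (auto simp: R_def abs_if power2_eq_square)
  qed
  ultimately have "\<bar>R \<theta> \<theta>\<bar> \<le> 4 / 3 * (1 / 2 * N) * Q \<theta> \<theta>"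
    using V by (intro quadratic_net_bound[OF p bilinear_Q Q_sym]) auto
  \<comment> \<open>The deviation is at most \<open>4 / 3 * (1 / 2) = 2 / 3\<close> of
    \<open>N * Q\<close>, so a third of \<open>N * Q\<close> remains.\<close>
  then have lower: "N / 3 * Q \<theta> \<theta> \<le> (\<Sum>i\<in>{1..N}. (y \<theta> i)\<^sup>2)"
    by (simp add: R_def power2_eq_square abs_if split: if_splits)
  have "bilinear D"
    unfolding bilinear_def
    by (intro conjI allI linearI)
      (auto simp: D_def y_def inner_add_left sum.distrib sum_distrib_left algebra_simps)
  then have upper: "D b \<theta> \<le> 4 / 3 * (\<sigma>w * s) * norm b * sqrt (Q \<theta> \<theta>)"
    using U V good(3)
    by (intro bilinear_net_bound[OF equivalent_norm_norm p, of _ U V]) (auto simp: less_imp_le)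
  have y\<theta>: "y \<theta> i = (transpose (A' - A) *v b) \<bullet> x i T \<omega> + (transpose (B' - B) *v b) \<bullet> u i T \<omega>" for i
    by (simp add: y_def \<theta>_def z_def)
  have "\<omega> \<in> space M" using \<omega> by (simp add: good_event_def)
  then have "(\<Sum>i\<in>{1..N}. (y \<theta> i)\<^sup>2) = D b \<theta>"
    unfolding y\<theta> D_def
    by (intro least_squares_normal_equation[OF ls, where w = "\<lambda>i. w i T \<omega>"]) (simp add: x_step)
  with lower upper b have *: "N / 3 * Q \<theta> \<theta> \<le> 4 / 3 * (\<sigma>w * s) * sqrt (Q \<theta> \<theta>)" by simp
  have Q0: "Q \<theta> \<theta> \<ge> 0" using p.nonneg[of \<theta>] by simp
  have s: "\<sigma>w * s \<ge> 0"
    using \<sigma>w \<open>s \<ge> 0\<close> by simp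
  have "sqrt (Q \<theta> \<theta>) * sqrt (Q \<theta> \<theta>) \<le> (4 * \<sigma>w * s / N) * sqrt (Q \<theta> \<theta>)"
    using * Q0 N by (simp add: field_simps)
  then show ?thesis
    using s Q0 by (cases "Q \<theta> \<theta> = 0") (simp, metis mult_right_le_imp_le order_le_less real_sqrt_gt_0_iff)
qed

end

text \<open>A 1/8-net in dimension \<open>d\<close> has at most \<open>(1 + 2 / (1 / 8)) ^ d = 17 ^ d\<close> points.\<close>

lemma net_failure_bound:
  fixes \<delta> :: real
  assumes "0 < \<delta>" "\<delta> \<le> 1" "d \<ge> 1" and "k \<le> 17 ^ d" "e \<ge> real d * ln (54 / \<delta>)"
  shows "k * exp (- e) \<le> \<delta> / 3"
proof -
  let ?q = "17 * \<delta> / 54"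
  have "exp (- e) \<le> exp (real d * - ln (54 / \<delta>))" using assms by simp
  also have "\<dots> = (\<delta> / 54) ^ d"
    using assms by (simp add: exp_of_nat_mult exp_minus power_divide)
  finally have "k * exp (- e) \<le> 17 ^ d * (\<delta> / 54) ^ d"
    using assms by (intro mult_mono) auto
  also have "\<dots> = ?q ^ d" by (simp add: power_mult_distrib[symmetric])
  \<comment> \<open>As \<open>\<delta> \<le> 1\<close>, the base \<open>?q\<close> is below 1 and
    \<open>d \<ge> 1\<close> allows the power to be dropped; 17/54 is at most 18/54 = 1/3.\<close>
  also have "\<dots> \<le> ?q ^ 1" using assms by (intro power_decreasing) auto
  also have "\<dots> \<le> \<delta> / 3" using assms by simp
  finally show ?thesis .
qed

theorem theorem4:
  fixes M :: "'w measure"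
    and A :: "real^'n^'n" and B :: "real^'u^'n"
    and \<sigma>w \<sigma>u \<delta> :: real
    and T N :: nat
    and x w :: "nat \<Rightarrow> nat \<Rightarrow> 'w \<Rightarrow> real^'n"
    and u :: "nat \<Rightarrow> nat \<Rightarrow> 'w \<Rightarrow> real^'u"
    and Ahat :: "'w \<Rightarrow> real^'n^'n" and Bhat :: "'w \<Rightarrow> real^'u^'n"
  assumes "prob_space M"
    and "\<sigma>w > 0" and "\<sigma>u > 0" and "T \<ge> 1"
    and w_gauss: "\<And>i t. i \<in> {1..N} \<Longrightarrow> t \<le> T \<Longrightarrow>
          distributed M lborel (w i t) (\<lambda>v. ennreal (gaussian_density \<sigma>w v))"
    and u_gauss: "\<And>i t. i \<in> {1..N} \<Longrightarrow> t \<le> T \<Longrightarrow>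
          distributed M lborel (u i t) (\<lambda>v. ennreal (gaussian_density \<sigma>u v))"
    and indep: "mutually_independent M ({1..N} \<times> {..T}) w u"
    and x_init: "\<And>i \<omega>. i \<in> {1..N} \<Longrightarrow> \<omega> \<in> space M \<Longrightarrow> x i 0 \<omega> = 0"
    and x_step: "\<And>i t \<omega>. i \<in> {1..N} \<Longrightarrow> t \<le> T \<Longrightarrow> \<omega> \<in> space M \<Longrightarrow>
          x i (Suc t) \<omega> = A *v x i t \<omega> + B *v u i t \<omega> + w i t \<omega>"
    and least_squares: "\<And>\<omega>. \<omega> \<in> space M \<Longrightarrow>
          is_arg_min (ls_loss N T (\<lambda>i t. x i t \<omega>) (\<lambda>i t. u i t \<omega>)) (\<lambda>_. True)
            (Ahat \<omega>, Bhat \<omega>)"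
    and "0 < \<delta>" and "\<delta> \<le> 1"
    and N_large: "real N \<ge> 24 * real (CARD('n) + CARD('u)) * ln (54 / \<delta>)"
  shows "\<exists>E \<in> sets M. measure M E \<ge> 1 - \<delta> \<and>
    (\<forall>\<omega>\<in>E.
       spectral_norm (Ahat \<omega> - A)
         \<le> 8 * \<sigma>w * min_eigenvalue (state_covariance A B \<sigma>w \<sigma>u T) powr (- 1 / 2)
           * sqrt (real (2 * CARD('n) + CARD('u)) * ln (54 / \<delta>) / real N)
     \<and> spectral_norm (Bhat \<omega> - B)
         \<le> 8 * \<sigma>w / \<sigma>u
           * sqrt (real (2 * CARD('n) + CARD('u)) * ln (54 / \<delta>) / real N))"
proof -
  interpret prob_space M by fact
  let ?n = "CARD('n)" and ?p = "CARD('u)"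
  define L where "L = ln (54 / \<delta>)"
  have L: "L > 0" unfolding L_def using \<open>0 < \<delta>\<close> \<open>\<delta> \<le> 1\<close> by (intro ln_gt_zero) (simp add: field_simps)
  have N_large: "real N \<ge> 24 * real (?n + ?p) * L" using N_large by (simp add: L_def)
  moreover have "24 * real (?n + ?p) * L > 0" using L by (intro mult_pos_pos) (auto intro!: add_pos_pos)
  ultimately have N: "N > 0" by linarith
  interpret linear_experiments M A B \<sigma>w \<sigma>u T N x w u
    by unfold_locales (fact | rule N)+
  obtain C where p: "equivalent_norm (\<lambda>v. sqrt (Q v v)) (min \<sigma>w \<sigma>u) C"
    using equivalent_norm_sqrt[OF bilinear_Q Q_sym _ Q_lower(3)] \<open>\<sigma>w > 0\<close> \<open>\<sigma>u > 0\<close> by auto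
  obtain V where V: "finite V" "V \<subseteq> {v. Q v v = 1}" "real (card V) \<le> 17 ^ (?n + ?p)"
    "\<And>v. Q v v = 1 \<Longrightarrow> \<exists>v'\<in>V. sqrt (Q (v - v') (v - v')) \<le> 1 / 8"
  proof (rule equivalent_norm.exists_net[OF p, of "1 / 8"])
    fix S assume "finite S" "S \<subseteq> {v. sqrt (Q v v) = 1}"
      "real (card S) \<le> (1 + 2 / (1 / 8)) ^ DIM((real^'n) \<times> (real^'u))"
      "\<And>v. sqrt (Q v v) = 1 \<Longrightarrow> \<exists>w\<in>S. sqrt (Q (v - w) (v - w)) \<le> 1 / 8"
    then show thesis by (intro that[of S]) simp_all
  qed simp
  obtain U :: "(real^'n) set" where U: "finite U" "U \<subseteq> {b. norm b = 1}" "real (card U) \<le> 17 ^ ?n"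
    "\<And>b. norm b = 1 \<Longrightarrow> \<exists>b'\<in>U. norm (b - b') \<le> 1 / 8"
  proof (rule equivalent_norm.exists_net[OF equivalent_norm_norm, of "1 / 8"])
    fix S :: "(real^'n) set" assume "finite S" "S \<subseteq> {b. norm b = 1}"
      "real (card S) \<le> (1 + 2 / (1 / 8)) ^ DIM(real^'n)"
      "\<And>b. norm b = 1 \<Longrightarrow> \<exists>b'\<in>S. norm (b - b') \<le> 1 / 8"
    then show thesis by (intro that[of S]) simp_all
  qed simp
  \<comment> \<open>The exponent of 17 in the number of pairs from \<open>V\<close> and
    \<open>U\<close>, namely \<open>(?n + ?p) + ?n\<close>.\<close>
  define m where "m = 2 * ?n + ?p"
  \<comment> \<open>Chosen so that the cross-term exponent \<open>s^2 / (3 * N)\<close> equals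
    \<open>m * L\<close>.\<close>
  define s where "s = sqrt (3 * N * m * L)"
  have s: "s \<ge> 0" "s\<^sup>2 = 3 * N * m * L" using L by (auto simp: s_def)
  let ?E = "good_event V U s"
  show ?thesis
  proof (intro bexI conjI ballI)
    show "?E \<in> events" using V U by (intro good_event_measurable)
    \<comment> \<open>This bound counts twice, once for each energy tail; the cross term contributes
      the remaining \<delta>/3.\<close>
    have "real (card V) * exp (- (real N / 24)) \<le> \<delta> / 3"
    proof (rule net_failure_bound[OF _ _ _ V(3)])
      show "real N / 24 \<ge> real (?n + ?p) * ln (54 / \<delta>)" using N_large by (simp add: L_def algebra_simps)
    qed (use \<open>0 < \<delta>\<close> \<open>\<delta> \<le> 1\<close> in \<open>simp_all add: Suc_le_eq\<close>)
    moreover have "real (card V) * real (card U) * exp (- (s\<^sup>2 / (3 * N))) \<le> \<delta> / 3"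
    proof (rule net_failure_bound[of _ m])
      have "real (card V) * real (card U) \<le> 17 ^ (?n + ?p) * 17 ^ ?n"
        using V(3) U(3) by (intro mult_mono) simp_all
      also have "\<dots> = 17 ^ m"
      proof -
        have "m = (?n + ?p) + ?n" by (simp add: m_def)
        then show ?thesis by (simp only: power_add)
      qed
      finally show "real (card V) * real (card U) \<le> 17 ^ m" .
      show "s\<^sup>2 / (3 * N) \<ge> m * ln (54 / \<delta>)" using N by (simp add: s L_def)
    qed (use \<open>0 < \<delta>\<close> \<open>\<delta> \<le> 1\<close> in \<open>auto simp: m_def Suc_le_eq\<close>)
    ultimately show "1 - \<delta> \<le> prob ?E"
      using prob_good_event[OF V(1,2) U(1,2) s(1)] by simp
    fix \<omega> assume \<omega>: "\<omega> \<in> ?E"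
    then have "\<omega> \<in> space M" by (simp add: good_event_def)
    define rate where "rate = 8 * \<sigma>w * sqrt (m * L / N)"
    have err: "sqrt (Q \<theta> \<theta>) \<le> rate"
      if "norm b = 1" "\<theta> = (transpose (Ahat \<omega> - A) *v b, transpose (Bhat \<omega> - B) *v b)" for b \<theta>
    proof -
      have "(s / N)\<^sup>2 = 3 * (m * L / N)"
        using N unfolding power_divide s(2) by (simp add: power2_eq_square)
      then have "s / N = sqrt (3 * (m * L / N))"
        using s(1) by (intro real_sqrt_unique[symmetric]) simp_all
      then have eq: "4 * \<sigma>w * s / N = 4 * \<sigma>w * (sqrt 3 * sqrt (m * L / N))"
        by (metis real_sqrt_mult times_divide_eq_right)
      have "sqrt (Q \<theta> \<theta>) \<le> 4 * \<sigma>w * s / N"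
        unfolding that(2) using \<open>\<omega> \<in> space M\<close> V U
        by (intro estimation_error_bound[OF V(2,4) U(2,4) \<omega> least_squares that(1) s(1)])
      also have "\<dots> = 4 * \<sigma>w * (sqrt 3 * sqrt (m * L / N))" by (rule eq)
      \<comment> \<open>Rounding sqrt 3 up to 2 produces the constant 8.\<close>
      also have "\<dots> \<le> 4 * \<sigma>w * (2 * sqrt (m * L / N))"
        using \<open>\<sigma>w > 0\<close> L by (intro mult_left_mono mult_right_mono real_le_lsqrt) auto
      finally show ?thesis by (simp add: rate_def)
    qed
    have "spectral_norm (Ahat \<omega> - A) \<le> rate / sqrt (min_eigenvalue \<Sigma>x)"
    proof (rule spectral_norm_le_transpose)
      fix b :: "real^'n" assume b: "norm b = 1"
      let ?a = "transpose (Ahat \<omega> - A) *v b"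
      have "sqrt (min_eigenvalue \<Sigma>x * (norm ?a)\<^sup>2) \<le> rate"
        using order_trans[OF real_sqrt_le_mono[OF Q_lower(1)] err[OF b refl]] by simp
      then show "norm ?a \<le> rate / sqrt (min_eigenvalue \<Sigma>x)"
        using min_eigenvalue_pos by (simp add: real_sqrt_mult pos_le_divide_eq mult.commute)
    qed
    then show "spectral_norm (Ahat \<omega> - A) \<le> 8 * \<sigma>w * min_eigenvalue \<Sigma>x powr (- 1 / 2) *
        sqrt (real (2 * ?n + ?p) * ln (54 / \<delta>) / real N)"
      using min_eigenvalue_pos
      by (simp add: rate_def m_def L_def powr_minus_divide powr_half_sqrt mult_ac)
    have "spectral_norm (Bhat \<omega> - B) \<le> rate / \<sigma>u"
    proof (rule spectral_norm_le_transpose)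
      fix b :: "real^'n" assume b: "norm b = 1"
      let ?c = "transpose (Bhat \<omega> - B) *v b"
      have "sqrt (\<sigma>u\<^sup>2 * (norm ?c)\<^sup>2) \<le> rate"
        using order_trans[OF real_sqrt_le_mono[OF Q_lower(2)] err[OF b refl]] by simp
      then show "norm ?c \<le> rate / \<sigma>u"
        using \<open>\<sigma>u > 0\<close> by (simp add: real_sqrt_mult pos_le_divide_eq mult.commute)
    qed
    then show "spectral_norm (Bhat \<omega> - B) \<le> 8 * \<sigma>w / \<sigma>u *
        sqrt (real (2 * ?n + ?p) * ln (54 / \<delta>) / real N)"
      by (simp add: rate_def m_def L_def)
  qed
qed

end
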